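(* Let $M$ be a simply connected timelike surface, $E\to M$ a rank $2$ vector bundle with a Riemannian metric and a compatible connection, with spin structures given on $TM$ and $E$, let $\vec H\in\Gamma(E)$, and let $\varphi\in\Gamma(\Sigma)$ be a solution of $D\varphi=\vec H\cdot\varphi$ with $H(\varphi,\varphi)=1$. Let $F:M\to\mathbb R^{3,1}$ be the isometric immersion with $dF=\xi$, $\xi(X)=\langle\langle X\cdot\varphi,\varphi\rangle\rangle$. Then the Laplacian of $F$ is given by $$\Delta F=2\vec H,$$ where $\vec H$ (identified with the $\mathbb R^{3,1}$-valued function $\xi(\vec H)=\langle\langle\vec H\cdot\varphi,\varphi\rangle\rangle$) is the mean curvature vector of the immersion.
   Context: **Algebra.** $\mathbb H^{\mathbb C}=\{q_1 1+q_2I+q_3J+q_4K: q_j\in\mathbb C\}$ is the algebra of quaternions with complex coefficients ($I^2=J^2=K^2=-1$, $IJ=-JI=K$). For $q=q_1+q_2I+q_3J+q_4K$: $\overline q=q_1-q_2I-q_3J-q_4K$, and $\widehat q$ is obtained by complex-conjugating each coefficient $q_j$. $H(p,p')=\sum_k p_kp'_k\in\mathbb C$ and $\langle\cdot,\cdot\rangle=\Re e\,H$. Minkowski space $\mathbb R^{3,1}$ (metric $-dx_1^2+dx_2^2+dx_3^2+dx_4^2$) is identified with $\{ix_1 1+x_2I+x_3J+x_4K: x_j\in\mathbb R\}=\{q: q=-\widehat{\overline q}\}\subset\mathbb H^{\mathbb C}$. $Spin(3,1)=\{p\in\mathbb H^{\mathbb C}:H(p,p)=1\}$ double covers the identity component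 $SO(3,1)$ by $p\mapsto(q\mapsto p\,q\,\widehat p^{-1})$. A vector $v\in\mathbb R^{3,1}$ acts on $\xi\in\mathbb H^{\mathbb C}$ by $v\cdot\xi=v\,\widehat\xi$; a product $u\cdot v$ of two vectors acts by left multiplication by $u\widehat v$; $v\cdot v=-\langle v,v\rangle$. $Spin(1,1)=\{\pm(\cosh s+i\sinh s\,I)\}$ and $Spin(2)=\{\cos r+\sin r\,I\}$ ($s,r\in\mathbb R$) are the subgroups of $Spin(3,1)$ covering $SO(1,1)$ (acting on $\mathrm{span}(i1,I)$) and $SO(2)$ (acting on $\mathrm{span}(J,K)$). **Twisted spinor bundle.** $TM$ and $E$ are oriented; $\tilde Q_1$, $\tilde Q_2$ are the given spin structures (over the oriented orthonormal frame bundles of $TM$ and $E$), $\tilde Q=\tilde Q_1\times_M\tilde Q_2$, and $\Sigma=\Sigma M\otimes\Sigma E=\tilde Q\times\mathbb H^{\mathbb C}/\rho$ with $\rho(g_1,g_2)\xi=g_1g_2\xi$, equipped with the spinorial connection $\nabla$ induced by the Levi-Civita connection of $M$ and the connection of $E$, and with the Clifford action of $Cl(TM\oplus E)$. In a local section $\tilde s$ of $\tilde Q$ over an adapted orthonormal frame $(e_1,e_2,e_3,e_4)$ ($e_1,e_2\in TM$, $\langle e_1,e_1\rangle=-1$, $\langle e_2,e_2\rangle=1$; $e_3,e_4\in E$), a spinor $\varphi$ has a coordinate $[\varphi]\in\mathbb H^{\mathbb C}$, the vectors $e_1,e_2,e_3,e_4$ are represented by $i1,I,J,K$, and $[X\cdot\varphi]=[X]\widehat{[\varphi]}$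 for $X\in TM\oplus E$. $H(\psi,\psi')=H([\psi],[\psi'])$ and $\langle\langle\psi,\psi'\rangle\rangle=\overline{[\psi']}\,[\psi]\in\mathbb H^{\mathbb C}$ are well defined on $\Sigma$. Dirac operator: $D\varphi=-e_1\cdot\nabla_{e_1}\varphi+e_2\cdot\nabla_{e_2}\varphi$. For such $\varphi$ the form $\xi(X)=\langle\langle X\cdot\varphi,\varphi\rangle\rangle$ ($X\in TM$) is closed with values in $\mathbb R^{3,1}$, its primitive $F$ is an isometric immersion, and $X\in E\mapsto\xi(X)$ identifies $E$ isometrically with the normal bundle. The Laplacian of a vector-valued function is $\Delta F=-\nabla dF(e_1,e_1)+\nabla dF(e_2,e_2)$ (the trace of the Hessian for the Lorentzian metric). The mean curvature vector is half the metric trace of the second fundamental form. *)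

theory Defs
  imports "HOL-Analysis.Analysis" "HOL-Library.Function_Algebras"
begin

section \<open>Complex quaternions and Minkowski space\<close>

text \<open>A complex quaternion \<open>q1 1 + q2 I + q3 J + q4 K\<close> is the vector of its coefficients. The
  product is \<open>qmult\<close>; the componentwise product that the library puts on vectors is not used.\<close>

type_synonym hc = "complex ^ 4"

definition hq :: "complex \<Rightarrow> complex \<Rightarrow> complex \<Rightarrow> complex \<Rightarrow> hc" where
  "hq a b c d = vector [a, b, c, d]"

definition qmult :: "hc \<Rightarrow> hc \<Rightarrow> hc"  (infixl \<open>\<odot>\<close> 70) where
  "p \<odot> q = hq
     (p$1 * q$1 - p$2 * q$2 - p$3 * q$3 - p$4 * q$4)
     (p$1 * q$2 + p$2 * q$1 + p$3 * q$4 - p$4 * q$3)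
     (p$1 * q$3 - p$2 * q$4 + p$3 * q$1 + p$4 * q$2)
     (p$1 * q$4 + p$2 * q$3 - p$3 * q$2 + p$4 * q$1)"

definition qone :: hc where "qone = hq 1 0 0 0"
definition qI :: hc where "qI = hq 0 1 0 0"
definition qJ :: hc where "qJ = hq 0 0 1 0"
definition qK :: hc where "qK = hq 0 0 0 1"

definition qconj :: "hc \<Rightarrow> hc" where
  "qconj q = hq (q$1) (- q$2) (- q$3) (- q$4)"

definition qhat :: "hc \<Rightarrow> hc" where
  "qhat q = (\<chi> k. cnj (q$k))"

definition Hform :: "hc \<Rightarrow> hc \<Rightarrow> complex" where
  "Hform p q = (\<Sum>k\<in>UNIV. p$k * q$k)"

definition mink :: "hc \<Rightarrow> hc \<Rightarrow> real" where
  "mink p q = Re (Hform p q)"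

definition R31 :: "hc set" where
  "R31 = {hq (\<i> * of_real x1) (of_real x2) (of_real x3) (of_real x4) | x1 x2 x3 x4. True}"

definition qinv :: "hc \<Rightarrow> hc" where
  "qinv p = inverse (Hform p p) *s qconj p"

definition Spin11 :: "hc set" where
  "Spin11 = {\<epsilon> *\<^sub>R hq (of_real (cosh s)) (\<i> * of_real (sinh s)) 0 0 | \<epsilon> s. \<epsilon> \<in> {1, - 1 :: real}}"

definition Spin2 :: "hc set" where
  "Spin2 = {hq (of_real (cos r)) (of_real (sin r)) 0 0 | r. True}"

definition spin_cover :: "hc \<Rightarrow> hc \<Rightarrow> hc" where
  "spin_cover p q = p \<odot> q \<odot> qinv (qhat p)"


section \<open>Smooth surfaces\<close>

primrec Ck_on :: "nat \<Rightarrow> 'a::real_normed_vector set \<Rightarrow> ('a \<Rightarrow> 'b::real_normed_vector) \<Rightarrow> bool" where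
  "Ck_on 0 S f \<longleftrightarrow> continuous_on S f"
| "Ck_on (Suc n) S f \<longleftrightarrow> (\<forall>x\<in>S. f differentiable at x) \<and>
     (\<forall>v. Ck_on n S (\<lambda>x. frechet_derivative f (at x) v))"

definition smooth_on :: "'a::real_normed_vector set \<Rightarrow> ('a \<Rightarrow> 'b::real_normed_vector) \<Rightarrow> bool" where
  "smooth_on S f \<longleftrightarrow> (\<forall>n. Ck_on n S f)"

text \<open>A chart is its domain together with the coordinate map; values of the map outside the domain
  are irrelevant. The surface itself is the whole type \<open>'m\<close>.\<close>

type_synonym 'm chart = "'m set \<times> ('m \<Rightarrow> real ^ 2)"

abbreviation chart_inv :: "'m chart \<Rightarrow> real ^ 2 \<Rightarrow> 'm" where
  "chart_inv k \<equiv> inv_into (fst k) (snd k)"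

definition smooth_map :: "'m::topological_space chart set \<Rightarrow> 'm set \<Rightarrow> ('m \<Rightarrow> 'b::real_normed_vector) \<Rightarrow> bool" where
  "smooth_map A W f \<longleftrightarrow> open W \<and>
     (\<forall>k\<in>A. smooth_on (snd k ` (fst k \<inter> W)) (f \<circ> chart_inv k))"

definition smooth_surface :: "'m::{t2_space,second_countable_topology} chart set \<Rightarrow> bool" where
  "smooth_surface A \<longleftrightarrow>
     (\<forall>k\<in>A. open (fst k) \<and> open (snd k ` fst k) \<and>
        homeomorphism (fst k) (snd k ` fst k) (snd k) (chart_inv k)) \<and>
     (\<Union>k\<in>A. fst k) = UNIV \<and>
     (\<forall>k\<in>A. \<forall>l\<in>A. smooth_on (snd k ` (fst k \<inter> fst l)) (snd l \<circ> chart_inv k))"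

definition chart_deriv :: "'m chart \<Rightarrow> 'm \<Rightarrow> ('m \<Rightarrow> 'b::real_normed_vector) \<Rightarrow> real ^ 2 \<Rightarrow> 'b" where
  "chart_deriv k p f u = frechet_derivative (f \<circ> chart_inv k) (at (snd k p)) u"

text \<open>A tangent vector at \<open>p\<close> is the family of its components in the charts around \<open>p\<close>, related by
  the Jacobians of the chart changes (and extended by zero to the remaining charts). Tangent vectors
  are added and scaled chart by chart.\<close>

type_synonym 'm tvec = "'m chart \<Rightarrow> real ^ 2"

instantiation "fun" :: (type, real_vector) real_vector
begin
definition scaleR_fun :: "real \<Rightarrow> ('a \<Rightarrow> 'b) \<Rightarrow> 'a \<Rightarrow> 'b" where
  "scaleR_fun r f = (\<lambda>x. r *\<^sub>R f x)"
instance
  by standard (simp_all add: scaleR_fun_def plus_fun_def fun_eq_iff scaleR_add_left scaleR_add_right)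
end

definition tangent :: "'m chart set \<Rightarrow> 'm \<Rightarrow> 'm tvec set" where
  "tangent A p = {v. (\<forall>k. \<not> (k \<in> A \<and> p \<in> fst k) \<longrightarrow> v k = 0) \<and>
     (\<forall>k\<in>A. \<forall>l\<in>A. p \<in> fst k \<and> p \<in> fst l \<longrightarrow> v l = chart_deriv k p (snd l) (v k))}"

text \<open>The derivative at \<open>p\<close> of \<open>f\<close> in the direction \<open>v\<close>; it does not depend on the chart used.\<close>

definition deriv_along :: "'m chart set \<Rightarrow> 'm \<Rightarrow> 'm tvec \<Rightarrow> ('m \<Rightarrow> 'b::real_normed_vector) \<Rightarrow> 'b" where
  "deriv_along A p v f =
     (let k = (SOME k. k \<in> A \<and> p \<in> fst k) in chart_deriv k p f (v k))"


section \<open>Vector bundles of rank 2\<close>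

text \<open>A rank 2 vector bundle is a family of planes inside one ambient real vector space (for an
  abstract bundle, the direct sum of its fibres), with a trivialising set of local frames
  \<open>(U, b1, b2)\<close> whose changes of frame are smooth.\<close>

record ('m, 'v) vbundle =
  fibre :: "'m \<Rightarrow> 'v set"
  frames :: "('m set \<times> ('m \<Rightarrow> 'v) \<times> ('m \<Rightarrow> 'v)) set"

definition is_basis :: "'v::real_vector set \<Rightarrow> 'v \<Rightarrow> 'v \<Rightarrow> bool" where
  "is_basis V b1 b2 \<longleftrightarrow> b1 \<noteq> b2 \<and> independent {b1, b2} \<and> span {b1, b2} = V"

definition smooth_section ::
  "'m::topological_space chart set \<Rightarrow> ('m, 'v::real_vector) vbundle \<Rightarrow> 'm set \<Rightarrow> ('m \<Rightarrow> 'v) \<Rightarrow> bool" where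
  "smooth_section A B W s \<longleftrightarrow> open W \<and> (\<forall>x\<in>W. s x \<in> fibre B x) \<and>
     (\<forall>(U, b1, b2)\<in>frames B. \<exists>f1 f2 :: 'm \<Rightarrow> real.
        smooth_map A (U \<inter> W) f1 \<and> smooth_map A (U \<inter> W) f2 \<and>
        (\<forall>x\<in>U \<inter> W. s x = f1 x *\<^sub>R b1 x + f2 x *\<^sub>R b2 x))"

definition vector_bundle2 ::
  "'m::topological_space chart set \<Rightarrow> ('m, 'v::real_vector) vbundle \<Rightarrow> bool" where
  "vector_bundle2 A B \<longleftrightarrow>
     (\<Union>(U, b1, b2)\<in>frames B. U) = UNIV \<and>
     (\<forall>(U, b1, b2)\<in>frames B. (\<forall>x\<in>U. is_basis (fibre B x) (b1 x) (b2 x)) \<and>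
        smooth_section A B U b1 \<and> smooth_section A B U b2)"

definition tangent_bundle :: "'m chart set \<Rightarrow> ('m, 'm tvec) vbundle" where
  "tangent_bundle A =
     (let coord_field = (\<lambda>k i x l. if l \<in> A \<and> x \<in> fst l then chart_deriv k x (snd l) (axis i 1) else 0)
      in \<lparr>fibre = tangent A, frames = {(fst k, coord_field k 1, coord_field k 2) | k. k \<in> A}\<rparr>)"

text \<open>A connection acts on a section defined near \<open>p\<close>. Since a section is represented by a total
  function, locality has to be required.\<close>

definition connection :: "'m::topological_space chart set \<Rightarrow> ('m, 'v::real_vector) vbundle \<Rightarrow>
    ('m \<Rightarrow> 'm tvec \<Rightarrow> ('m \<Rightarrow> 'v) \<Rightarrow> 'v) \<Rightarrow> bool" where
  "connection A B nab \<longleftrightarrow>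
     (\<forall>W p s v. smooth_section A B W s \<and> p \<in> W \<and> v \<in> tangent A p \<longrightarrow> nab p v s \<in> fibre B p) \<and>
     (\<forall>W p s v w a b. smooth_section A B W s \<and> p \<in> W \<and> v \<in> tangent A p \<and> w \<in> tangent A p \<longrightarrow>
        nab p (a *\<^sub>R v + b *\<^sub>R w) s = a *\<^sub>R nab p v s + b *\<^sub>R nab p w s) \<and>
     (\<forall>W p s t v. smooth_section A B W s \<and> smooth_section A B W t \<and> p \<in> W \<and> v \<in> tangent A p \<longrightarrow>
        nab p v (\<lambda>x. s x + t x) = nab p v s + nab p v t) \<and>
     (\<forall>W p f s v. smooth_map A W f \<and> smooth_section A B W s \<and> p \<in> W \<and> v \<in> tangent A p \<longrightarrow>
        nab p v (\<lambda>x. f x *\<^sub>R s x) = deriv_along A p v f *\<^sub>R s p + f p *\<^sub>R nab p v s) \<and>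
     (\<forall>W p s t v. smooth_section A B W s \<and> p \<in> W \<and> v \<in> tangent A p \<and> (\<forall>x\<in>W. s x = t x) \<longrightarrow>
        nab p v s = nab p v t) \<and>
     (\<forall>W X s. smooth_section A (tangent_bundle A) W X \<and> smooth_section A B W s \<longrightarrow>
        smooth_section A B W (\<lambda>x. nab x (X x) s))"

definition bundle_metric :: "'m::topological_space chart set \<Rightarrow> ('m, 'v::real_vector) vbundle \<Rightarrow>
    ('m \<Rightarrow> 'v \<Rightarrow> 'v \<Rightarrow> real) \<Rightarrow> bool" where
  "bundle_metric A B h \<longleftrightarrow>
     (\<forall>p. \<forall>u\<in>fibre B p. \<forall>v\<in>fibre B p. h p u v = h p v u) \<and>
     (\<forall>p. \<forall>u\<in>fibre B p. \<forall>v\<in>fibre B p. \<forall>w\<in>fibre B p. \<forall>a b.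
        h p (a *\<^sub>R u + b *\<^sub>R v) w = a * h p u w + b * h p v w) \<and>
     (\<forall>W s t. smooth_section A B W s \<and> smooth_section A B W t \<longrightarrow>
        smooth_map A W (\<lambda>x. h x (s x) (t x)))"

definition compatible :: "'m::topological_space chart set \<Rightarrow> ('m, 'v::real_vector) vbundle \<Rightarrow>
    ('m \<Rightarrow> 'v \<Rightarrow> 'v \<Rightarrow> real) \<Rightarrow> ('m \<Rightarrow> 'm tvec \<Rightarrow> ('m \<Rightarrow> 'v) \<Rightarrow> 'v) \<Rightarrow> bool" where
  "compatible A B h nab \<longleftrightarrow>
     (\<forall>W p s t v. smooth_section A B W s \<and> smooth_section A B W t \<and> p \<in> W \<and> v \<in> tangent A p \<longrightarrow>
        deriv_along A p v (\<lambda>x. h x (s x) (t x)) = h p (nab p v s) (t p) + h p (s p) (nab p v t))"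

definition riemannian :: "'m::topological_space chart set \<Rightarrow> ('m, 'v::real_vector) vbundle \<Rightarrow>
    ('m \<Rightarrow> 'v \<Rightarrow> 'v \<Rightarrow> real) \<Rightarrow> bool" where
  "riemannian A B h \<longleftrightarrow> bundle_metric A B h \<and> (\<forall>p. \<forall>v\<in>fibre B p. v \<noteq> 0 \<longrightarrow> h p v v > 0)"

definition orientation :: "'m::topological_space chart set \<Rightarrow> ('m, 'v::real_vector) vbundle \<Rightarrow>
    ('m \<Rightarrow> ('v \<times> 'v) set) \<Rightarrow> bool" where
  "orientation A B pos \<longleftrightarrow> (\<forall>p. \<exists>U b1 b2. p \<in> U \<and>
     smooth_section A B U b1 \<and> smooth_section A B U b2 \<and>
     (\<forall>x\<in>U. is_basis (fibre B x) (b1 x) (b2 x) \<and>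
        pos x = {(a *\<^sub>R b1 x + b *\<^sub>R b2 x, c *\<^sub>R b1 x + d *\<^sub>R b2 x) | a b c d :: real. a * d - b * c > 0}))"


section \<open>Lorentzian surfaces\<close>

definition is_lorentz_onb ::
  "'m chart set \<Rightarrow> ('m \<Rightarrow> 'm tvec \<Rightarrow> 'm tvec \<Rightarrow> real) \<Rightarrow> 'm \<Rightarrow> 'm tvec \<times> 'm tvec \<Rightarrow> bool" where
  "is_lorentz_onb A g p = (\<lambda>(e1, e2). is_basis (tangent A p) e1 e2 \<and>
     g p e1 e1 = - 1 \<and> g p e2 e2 = 1 \<and> g p e1 e2 = 0)"

definition lorentzian :: "'m::topological_space chart set \<Rightarrow> ('m \<Rightarrow> 'm tvec \<Rightarrow> 'm tvec \<Rightarrow> real) \<Rightarrow> bool" where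
  "lorentzian A g \<longleftrightarrow> bundle_metric A (tangent_bundle A) g \<and> (\<forall>p. \<exists>e. is_lorentz_onb A g p e)"

definition time_orientation :: "'m::topological_space chart set \<Rightarrow> ('m \<Rightarrow> 'm tvec \<Rightarrow> 'm tvec \<Rightarrow> real) \<Rightarrow>
    ('m \<Rightarrow> 'm tvec set) \<Rightarrow> bool" where
  "time_orientation A g fut \<longleftrightarrow> (\<forall>p. \<exists>U T. p \<in> U \<and> smooth_section A (tangent_bundle A) U T \<and>
     (\<forall>x\<in>U. g x (T x) (T x) < 0 \<and> fut x = {v \<in> tangent A x. g x v v < 0 \<and> g x v (T x) < 0}))"

definition lie_bracket :: "'m chart set \<Rightarrow> ('m \<Rightarrow> 'm tvec) \<Rightarrow> ('m \<Rightarrow> 'm tvec) \<Rightarrow> 'm \<Rightarrow> 'm tvec" where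
  "lie_bracket A X Y p = (\<lambda>k. if k \<in> A \<and> p \<in> fst k
     then chart_deriv k p (\<lambda>x. Y x k) (X p k) - chart_deriv k p (\<lambda>x. X x k) (Y p k) else 0)"

definition levi_civita :: "'m::topological_space chart set \<Rightarrow> ('m \<Rightarrow> 'm tvec \<Rightarrow> 'm tvec \<Rightarrow> real) \<Rightarrow>
    ('m \<Rightarrow> 'm tvec \<Rightarrow> ('m \<Rightarrow> 'm tvec) \<Rightarrow> 'm tvec) \<Rightarrow> bool" where
  "levi_civita A g nab \<longleftrightarrow> connection A (tangent_bundle A) nab \<and> compatible A (tangent_bundle A) g nab \<and>
     (\<forall>W X Y p. smooth_section A (tangent_bundle A) W X \<and> smooth_section A (tangent_bundle A) W Y \<and>
        p \<in> W \<longrightarrow> nab p (X p) Y - nab p (Y p) X = lie_bracket A X Y p)"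

definition lorentz_onb ::
  "'m chart set \<Rightarrow> ('m \<Rightarrow> 'm tvec \<Rightarrow> 'm tvec \<Rightarrow> real) \<Rightarrow> 'm \<Rightarrow> 'm tvec \<times> 'm tvec" where
  "lorentz_onb A g p = (SOME e. is_lorentz_onb A g p e)"

text \<open>The trace of a bilinear map on \<open>T\<^sub>pM\<close>, computed in an arbitrary orthonormal basis.\<close>

definition lorentz_trace :: "'m chart set \<Rightarrow> ('m \<Rightarrow> 'm tvec \<Rightarrow> 'm tvec \<Rightarrow> real) \<Rightarrow> 'm \<Rightarrow>
    ('m tvec \<Rightarrow> 'm tvec \<Rightarrow> 'b::real_vector) \<Rightarrow> 'b" where
  "lorentz_trace A g p b = (let (e1, e2) = lorentz_onb A g p in - b e1 e1 + b e2 e2)"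


section \<open>Maps into Minkowski space\<close>

definition differential :: "'m chart set \<Rightarrow> ('m \<Rightarrow> 'b::real_normed_vector) \<Rightarrow> 'm \<Rightarrow> 'm tvec \<Rightarrow> 'b" where
  "differential A F p v = deriv_along A p v F"

definition pullback_metric :: "'m chart set \<Rightarrow> ('m \<Rightarrow> hc) \<Rightarrow> 'm \<Rightarrow> 'm tvec \<Rightarrow> 'm tvec \<Rightarrow> real" where
  "pullback_metric A F p v w = mink (differential A F p v) (differential A F p w)"

definition isometric_immersion :: "'m::topological_space chart set \<Rightarrow> ('m \<Rightarrow> 'm tvec \<Rightarrow> 'm tvec \<Rightarrow> real) \<Rightarrow>
    ('m \<Rightarrow> hc) \<Rightarrow> bool" where
  "isometric_immersion A g F \<longleftrightarrow> smooth_map A UNIV F \<and> (\<forall>p. F p \<in> R31) \<and>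
     (\<forall>p. inj_on (differential A F p) (tangent A p)) \<and>
     (\<forall>p. \<forall>v\<in>tangent A p. \<forall>w\<in>tangent A p. pullback_metric A F p v w = g p v w)"

text \<open>Some vector field near \<open>p\<close> with the value \<open>w\<close> at \<open>p\<close>; neither the Hessian nor the second
  fundamental form depends on the choice.\<close>

definition field_extending :: "'m::topological_space chart set \<Rightarrow> 'm \<Rightarrow> 'm tvec \<Rightarrow> 'm \<Rightarrow> 'm tvec" where
  "field_extending A p w =
     (SOME Y. \<exists>U. p \<in> U \<and> smooth_section A (tangent_bundle A) U Y \<and> Y p = w)"

definition hessian :: "'m::topological_space chart set \<Rightarrow> ('m \<Rightarrow> 'm tvec \<Rightarrow> ('m \<Rightarrow> 'm tvec) \<Rightarrow> 'm tvec) \<Rightarrow>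
    ('m \<Rightarrow> 'b::real_normed_vector) \<Rightarrow> 'm \<Rightarrow> 'm tvec \<Rightarrow> 'm tvec \<Rightarrow> 'b" where
  "hessian A nab F p v w = (let Y = field_extending A p w in
     deriv_along A p v (\<lambda>x. differential A F x (Y x)) - differential A F p (nab p v Y))"

definition laplacian :: "'m::topological_space chart set \<Rightarrow> ('m \<Rightarrow> 'm tvec \<Rightarrow> 'm tvec \<Rightarrow> real) \<Rightarrow>
    ('m \<Rightarrow> 'm tvec \<Rightarrow> ('m \<Rightarrow> 'm tvec) \<Rightarrow> 'm tvec) \<Rightarrow> ('m \<Rightarrow> 'b::real_normed_vector) \<Rightarrow> 'm \<Rightarrow> 'b" where
  "laplacian A g nab F p = lorentz_trace A g p (hessian A nab F p)"

definition normal_part :: "'m chart set \<Rightarrow> ('m \<Rightarrow> hc) \<Rightarrow> 'm \<Rightarrow> hc \<Rightarrow> hc" where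
  "normal_part A F p z = (THE n. n \<in> R31 \<and>
     (\<forall>u\<in>tangent A p. mink n (differential A F p u) = 0) \<and>
     (\<exists>u\<in>tangent A p. z = differential A F p u + n))"

definition second_fundamental_form ::
  "'m::topological_space chart set \<Rightarrow> ('m \<Rightarrow> hc) \<Rightarrow> 'm \<Rightarrow> 'm tvec \<Rightarrow> 'm tvec \<Rightarrow> hc" where
  "second_fundamental_form A F p v w =
     normal_part A F p (deriv_along A p v (\<lambda>x. differential A F x (field_extending A p w x)))"

definition mean_curvature :: "'m::topological_space chart set \<Rightarrow> ('m \<Rightarrow> hc) \<Rightarrow> 'm \<Rightarrow> hc" where
  "mean_curvature A F p =
     (1/2) *\<^sub>R lorentz_trace A (pullback_metric A F) p (second_fundamental_form A F p)"


section \<open>Spin structures\<close>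

text \<open>The matrix of \<open>spin_cover g\<close> in the basis \<open>i1, I\<close> (respectively \<open>J, K\<close>) acts on a frame from
  the right.\<close>

definition frame_act11 :: "hc \<Rightarrow> 'v::real_vector \<times> 'v \<Rightarrow> 'v \<times> 'v" where
  "frame_act11 g = (\<lambda>(e1, e2).
     (let u = spin_cover g (\<i> *s qone); v = spin_cover g qI in
      (Im (u$1) *\<^sub>R e1 + Re (u$2) *\<^sub>R e2, Im (v$1) *\<^sub>R e1 + Re (v$2) *\<^sub>R e2)))"

definition frame_act2 :: "hc \<Rightarrow> 'v::real_vector \<times> 'v \<Rightarrow> 'v \<times> 'v" where
  "frame_act2 g = (\<lambda>(e3, e4).
     (let u = spin_cover g qJ; v = spin_cover g qK in
      (Re (u$3) *\<^sub>R e3 + Re (u$4) *\<^sub>R e4, Re (v$3) *\<^sub>R e3 + Re (v$4) *\<^sub>R e4)))"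

text \<open>\<open>Spin11\<close> covers only the identity component of the isometries of \<open>span(i1, I)\<close>, which preserves
  orientation and time orientation; the frames of the corresponding bundle are those that are
  positively oriented with future-directed first vector.\<close>

definition frames11 :: "'m chart set \<Rightarrow> ('m \<Rightarrow> 'm tvec \<Rightarrow> 'm tvec \<Rightarrow> real) \<Rightarrow> ('m \<Rightarrow> ('m tvec \<times> 'm tvec) set) \<Rightarrow>
    ('m \<Rightarrow> 'm tvec set) \<Rightarrow> 'm \<Rightarrow> ('m tvec \<times> 'm tvec) set" where
  "frames11 A g pos fut p = {e \<in> pos p. is_lorentz_onb A g p e \<and> fst e \<in> fut p}"

definition frames2 :: "('m \<Rightarrow> 'v \<Rightarrow> 'v \<Rightarrow> real) \<Rightarrow> ('m \<Rightarrow> ('v \<times> 'v) set) \<Rightarrow> 'm \<Rightarrow> ('v \<times> 'v) set" where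
  "frames2 h pos p = {(e3, e4) \<in> pos p. h p e3 e3 = 1 \<and> h p e4 e4 = 1 \<and> h p e3 e4 = 0}"

text \<open>A principal bundle is given by its total space, projection, right action, and a trivialising set
  of local sections whose transition functions are smooth; \<open>cover\<close> is the equivariant map to the
  frame bundle. As the group covers the structure group of the frame bundle twice, so does the total
  space its base.\<close>

record ('m, 'v, 'q) spin_bundle =
  total :: "'q set"
  proj :: "'q \<Rightarrow> 'm"
  act :: "'q \<Rightarrow> hc \<Rightarrow> 'q"
  cover :: "'q \<Rightarrow> 'v \<times> 'v"
  sections :: "('m set \<times> ('m \<Rightarrow> 'q)) set"

definition spin_structure :: "'m::topological_space chart set \<Rightarrow> ('m, 'v::real_vector) vbundle \<Rightarrow>
    ('m \<Rightarrow> ('v \<times> 'v) set) \<Rightarrow> hc set \<Rightarrow> (hc \<Rightarrow> 'v \<times> 'v \<Rightarrow> 'v \<times> 'v) \<Rightarrow>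
    ('m, 'v, 'q) spin_bundle \<Rightarrow> bool" where
  "spin_structure A B Q G frame_act P \<longleftrightarrow>
     (\<forall>q\<in>total P. \<forall>g\<in>G. act P q g \<in> total P \<and> proj P (act P q g) = proj P q) \<and>
     (\<forall>q\<in>total P. act P q qone = q) \<and>
     (\<forall>q\<in>total P. \<forall>g\<in>G. \<forall>h\<in>G. act P (act P q g) h = act P q (g \<odot> h)) \<and>
     (\<forall>q\<in>total P. \<forall>q'\<in>total P. proj P q = proj P q' \<longrightarrow> (\<exists>!g. g \<in> G \<and> q' = act P q g)) \<and>
     (\<Union>(U, s)\<in>sections P. U) = UNIV \<and>
     (\<forall>(U, s)\<in>sections P. open U \<and> (\<forall>x\<in>U. s x \<in> total P \<and> proj P (s x) = x)) \<and>
     (\<forall>(U, s)\<in>sections P. \<forall>(V, t)\<in>sections P. \<exists>g. smooth_map A (U \<inter> V) g \<and>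
        (\<forall>x\<in>U \<inter> V. g x \<in> G \<and> t x = act P (s x) (g x))) \<and>
     (\<forall>q\<in>total P. cover P q \<in> Q (proj P q)) \<and>
     (\<forall>q\<in>total P. \<forall>g\<in>G. cover P (act P q g) = frame_act g (cover P q)) \<and>
     (\<forall>(U, s)\<in>sections P. smooth_section A B U (\<lambda>x. fst (cover P (s x))) \<and>
        smooth_section A B U (\<lambda>x. snd (cover P (s x))))"

definition local_section :: "'m::topological_space chart set \<Rightarrow> hc set \<Rightarrow> ('m, 'v, 'q) spin_bundle \<Rightarrow>
    'm set \<Rightarrow> ('m \<Rightarrow> 'q) \<Rightarrow> bool" where
  "local_section A G P U s \<longleftrightarrow> open U \<and> (\<forall>x\<in>U. s x \<in> total P \<and> proj P (s x) = x) \<and>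
     (\<forall>(V, t)\<in>sections P. \<exists>g. smooth_map A (U \<inter> V) g \<and>
        (\<forall>x\<in>U \<inter> V. g x \<in> G \<and> s x = act P (t x) (g x)))"


section \<open>The twisted spinor bundle\<close>

record ('m, 'e, 'q1, 'q2) spinor_setting =
  atlas :: "'m chart set"
  metricM :: "'m \<Rightarrow> 'm tvec \<Rightarrow> 'm tvec \<Rightarrow> real"
  nablaM :: "'m \<Rightarrow> 'm tvec \<Rightarrow> ('m \<Rightarrow> 'm tvec) \<Rightarrow> 'm tvec"
  posM :: "'m \<Rightarrow> ('m tvec \<times> 'm tvec) set"
  futM :: "'m \<Rightarrow> 'm tvec set"
  spinM :: "('m, 'm tvec, 'q1) spin_bundle"
  bundleE :: "('m, 'e) vbundle"
  metricE :: "'m \<Rightarrow> 'e \<Rightarrow> 'e \<Rightarrow> real"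
  nablaE :: "'m \<Rightarrow> 'm tvec \<Rightarrow> ('m \<Rightarrow> 'e) \<Rightarrow> 'e"
  posE :: "'m \<Rightarrow> ('e \<times> 'e) set"
  spinE :: "('m, 'e, 'q2) spin_bundle"

definition timelike_surface ::
  "('m::{t2_space,second_countable_topology}, 'e, 'q1, 'q2) spinor_setting \<Rightarrow> bool" where
  "timelike_surface S \<longleftrightarrow> smooth_surface (atlas S) \<and> lorentzian (atlas S) (metricM S) \<and>
     levi_civita (atlas S) (metricM S) (nablaM S) \<and>
     orientation (atlas S) (tangent_bundle (atlas S)) (posM S) \<and>
     time_orientation (atlas S) (metricM S) (futM S)"

definition riemannian_bundle_E ::
  "('m::topological_space, 'e::real_vector, 'q1, 'q2) spinor_setting \<Rightarrow> bool" where
  "riemannian_bundle_E S \<longleftrightarrow> vector_bundle2 (atlas S) (bundleE S) \<and>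
     riemannian (atlas S) (bundleE S) (metricE S) \<and>
     connection (atlas S) (bundleE S) (nablaE S) \<and>
     compatible (atlas S) (bundleE S) (metricE S) (nablaE S) \<and>
     orientation (atlas S) (bundleE S) (posE S)"

definition spin_structures ::
  "('m::topological_space, 'e::real_vector, 'q1, 'q2) spinor_setting \<Rightarrow> bool" where
  "spin_structures S \<longleftrightarrow>
     spin_structure (atlas S) (tangent_bundle (atlas S))
       (frames11 (atlas S) (metricM S) (posM S) (futM S)) Spin11 frame_act11 (spinM S) \<and>
     spin_structure (atlas S) (bundleE S) (frames2 (metricE S) (posE S)) Spin2 frame_act2 (spinE S)"

text \<open>An element of the associated bundle is an equivalence class of triples \<open>(q1, q2, \<xi>)\<close> with
  \<open>(q1, q2)\<close> in the fibre product of the two spin structures, where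
  \<open>(q1 g1, q2 g2, \<zeta>)\<close> is equivalent to \<open>(q1, q2, g1 g2 \<zeta>)\<close>.\<close>

type_synonym ('q1, 'q2) spinor = "('q1 \<times> 'q2 \<times> hc) set"

definition spinor_class ::
  "('m, 'e, 'q1, 'q2) spinor_setting \<Rightarrow> 'q1 \<Rightarrow> 'q2 \<Rightarrow> hc \<Rightarrow> ('q1, 'q2) spinor" where
  "spinor_class S q1 q2 \<xi> = {(act (spinM S) q1 g1, act (spinE S) q2 g2, \<zeta>) | g1 g2 \<zeta>.
     g1 \<in> Spin11 \<and> g2 \<in> Spin2 \<and> g1 \<odot> g2 \<odot> \<zeta> = \<xi>}"

definition spinors :: "('m, 'e, 'q1, 'q2) spinor_setting \<Rightarrow> 'm \<Rightarrow> ('q1, 'q2) spinor set" where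
  "spinors S p = {spinor_class S q1 q2 \<xi> | q1 q2 \<xi>.
     q1 \<in> total (spinM S) \<and> proj (spinM S) q1 = p \<and> q2 \<in> total (spinE S) \<and> proj (spinE S) q2 = p}"

definition coord :: "('q1, 'q2) spinor \<Rightarrow> 'q1 \<Rightarrow> 'q2 \<Rightarrow> hc" where
  "coord \<psi> q1 q2 = (THE \<xi>. (q1, q2, \<xi>) \<in> \<psi>)"

definition smooth_spinor ::
  "('m::topological_space, 'e, 'q1, 'q2) spinor_setting \<Rightarrow> ('m \<Rightarrow> ('q1, 'q2) spinor) \<Rightarrow> bool" where
  "smooth_spinor S \<phi> \<longleftrightarrow> (\<forall>p. \<phi> p \<in> spinors S p) \<and>
     (\<forall>U s1 s2. local_section (atlas S) Spin11 (spinM S) U s1 \<and> local_section (atlas S) Spin2 (spinE S) U s2 \<longrightarrow>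
        smooth_map (atlas S) U (\<lambda>x. coord (\<phi> x) (s1 x) (s2 x)))"

text \<open>The operations on spinors are given by their action on all representatives.\<close>

definition spinor_add :: "('q1, 'q2) spinor \<Rightarrow> ('q1, 'q2) spinor \<Rightarrow> ('q1, 'q2) spinor" where
  "spinor_add \<psi> \<psi>' = {(q1, q2, \<xi> + \<xi>') | q1 q2 \<xi> \<xi>'. (q1, q2, \<xi>) \<in> \<psi> \<and> (q1, q2, \<xi>') \<in> \<psi>'}"

definition spinor_neg :: "('q1, 'q2) spinor \<Rightarrow> ('q1, 'q2) spinor" where
  "spinor_neg \<psi> = {(q1, q2, - \<xi>) | q1 q2 \<xi>. (q1, q2, \<xi>) \<in> \<psi>}"

definition spinor_H :: "('q1, 'q2) spinor \<Rightarrow> ('q1, 'q2) spinor \<Rightarrow> complex" where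
  "spinor_H \<psi> \<psi>' = (THE z. \<forall>q1 q2 \<xi> \<xi>'.
     (q1, q2, \<xi>) \<in> \<psi> \<and> (q1, q2, \<xi>') \<in> \<psi>' \<longrightarrow> z = Hform \<xi> \<xi>')"

definition spinor_pair :: "('q1, 'q2) spinor \<Rightarrow> ('q1, 'q2) spinor \<Rightarrow> hc" where
  "spinor_pair \<psi> \<psi>' = (THE z. \<forall>q1 q2 \<xi> \<xi>'.
     (q1, q2, \<xi>) \<in> \<psi> \<and> (q1, q2, \<xi>') \<in> \<psi>' \<longrightarrow> z = qconj \<xi>' \<odot> \<xi>)"

text \<open>The element of \<open>\<real>\<^sup>3\<^sup>,\<^sup>1\<close> representing \<open>X + Y\<close>, for \<open>X\<close> tangent and \<open>Y\<close> in the fibre of \<open>E\<close>, in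
  the adapted frame below \<open>(q1, q2)\<close>. The sign comes from \<open>X = - g(X, e1) e1 + g(X, e2) e2\<close>.\<close>

definition vec_coord :: "('m, 'e, 'q1, 'q2) spinor_setting \<Rightarrow> 'q1 \<Rightarrow> 'q2 \<Rightarrow> 'm tvec \<times> 'e \<Rightarrow> hc" where
  "vec_coord S q1 q2 = (\<lambda>(X, Y).
     (let p = proj (spinM S) q1; (e1, e2) = cover (spinM S) q1; (e3, e4) = cover (spinE S) q2 in
      hq (- \<i> * of_real (metricM S p X e1)) (of_real (metricM S p X e2))
         (of_real (metricE S p Y e3)) (of_real (metricE S p Y e4))))"

definition clifford ::
  "('m, 'e, 'q1, 'q2) spinor_setting \<Rightarrow> 'm tvec \<times> 'e \<Rightarrow> ('q1, 'q2) spinor \<Rightarrow> ('q1, 'q2) spinor" where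
  "clifford S Z \<psi> = {(q1, q2, vec_coord S q1 q2 Z \<odot> qhat \<xi>) | q1 q2 \<xi>. (q1, q2, \<xi>) \<in> \<psi>}"

text \<open>The connection form of the spinorial connection in a local section \<open>(s1, s2)\<close> over the frame
  \<open>(e1, e2, e3, e4)\<close>, namely
  \<open>1/2 (\<Sum>j<k. \<epsilon>\<^sub>j \<epsilon>\<^sub>k \<langle>\<nabla>\<^sub>v e\<^sub>j, e\<^sub>k\<rangle> e\<^sub>j \<cdot> e\<^sub>k)\<close> with \<open>\<epsilon>\<^sub>j = \<langle>e\<^sub>j, e\<^sub>j\<rangle>\<close>, in which \<open>e1 \<cdot> e2\<close> and
  \<open>e3 \<cdot> e4\<close> act by \<open>iI\<close> and \<open>I\<close>. It is the lift of the connection form of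
  \<open>TM \<oplus> E\<close> under the derivative \<open>\<eta> \<mapsto> (q \<mapsto> \<eta> q - q \<eta>^)\<close> of \<open>spin_cover\<close>.\<close>

definition spin_form :: "('m, 'e, 'q1, 'q2) spinor_setting \<Rightarrow> ('m \<Rightarrow> 'q1) \<Rightarrow> ('m \<Rightarrow> 'q2) \<Rightarrow>
    'm \<Rightarrow> 'm tvec \<Rightarrow> hc" where
  "spin_form S s1 s2 p v =
     (let e1 = (\<lambda>x. fst (cover (spinM S) (s1 x))); e2 = (\<lambda>x. snd (cover (spinM S) (s1 x)));
          e3 = (\<lambda>x. fst (cover (spinE S) (s2 x))); e4 = (\<lambda>x. snd (cover (spinE S) (s2 x)))
      in (- 1/2 * metricM S p (nablaM S p v e1) (e2 p)) *\<^sub>R ((\<i> *s qone) \<odot> qhat qI)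
         + (1/2 * metricE S p (nablaE S p v e3) (e4 p)) *\<^sub>R (qJ \<odot> qhat qK))"

text \<open>The class of \<open>(s1 p, s2 p, v[\<phi>] + \<eta>(v)[\<phi>])\<close>, all of whose representatives arise from
  some local section around \<open>p\<close>.\<close>

definition spin_nabla :: "('m::topological_space, 'e, 'q1, 'q2) spinor_setting \<Rightarrow>
    ('m \<Rightarrow> ('q1, 'q2) spinor) \<Rightarrow> 'm \<Rightarrow> 'm tvec \<Rightarrow> ('q1, 'q2) spinor" where
  "spin_nabla S \<phi> p v =
     {(s1 p, s2 p, deriv_along (atlas S) p v (\<lambda>x. coord (\<phi> x) (s1 x) (s2 x))
                   + spin_form S s1 s2 p v \<odot> coord (\<phi> p) (s1 p) (s2 p)) | U s1 s2.
        p \<in> U \<and> local_section (atlas S) Spin11 (spinM S) U s1 \<and>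
        local_section (atlas S) Spin2 (spinE S) U s2}"

definition dirac :: "('m::topological_space, 'e::real_vector, 'q1, 'q2) spinor_setting \<Rightarrow>
    ('m \<Rightarrow> ('q1, 'q2) spinor) \<Rightarrow> 'm \<Rightarrow> ('q1, 'q2) spinor" where
  "dirac S \<phi> p = (let (e1, e2) = lorentz_onb (atlas S) (metricM S) p in
     spinor_add (spinor_neg (clifford S (e1, 0) (spin_nabla S \<phi> p e1)))
                (clifford S (e2, 0) (spin_nabla S \<phi> p e2)))"

definition xi :: "('m, 'e, 'q1, 'q2) spinor_setting \<Rightarrow> ('m \<Rightarrow> ('q1, 'q2) spinor) \<Rightarrow>
    'm \<Rightarrow> 'm tvec \<times> 'e \<Rightarrow> hc" where
  "xi S \<phi> p Z = spinor_pair (clifford S Z (\<phi> p)) (\<phi> p)"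

end

theory Submission
  imports Defs
begin

text \<open>
  In a local spin frame let \<open>f\<close> be the coordinate of \<open>\<phi>\<close>, so that \<open>dF(Y) = qconj f [Y] qhat f\<close>.
  Differentiating, the connection form of the spinorial connection cancels against that of the frame,
  and \<open>Hess F(v,w) = qconj N [w] qhat f + qconj f [w] qhat N\<close>, where \<open>N\<close> is the coordinate of
  \<open>\<nabla>\<^sub>v \<phi>\<close>. By the Dirac equation the second terms have trace \<open>\<xi>(H)\<close>. Each first term is the image
  of the second one under \<open>q \<mapsto> - qhat (qconj q)\<close>, which fixes \<open>\<real>\<^sup>3\<^sup>,\<^sup>1\<close>, so the first terms contribute
  \<open>\<xi>(H)\<close> again. For the mean curvature it remains to see that \<open>Hess F(v,v)\<close> is normal for \<open>v\<close> in an
  orthonormal basis: writing \<open>N = M f\<close>, the scalar part of \<open>M\<close> vanishes because \<open>H(\<phi>,\<phi>) = 1\<close>,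
  and its \<open>I\<close>-part by the Dirac equation.
\<close>

section \<open>Complex quaternions\<close>

lemma hq_nth [simp]:
  "hq a b c d $ 1 = a" "hq a b c d $ 2 = b" "hq a b c d $ 3 = c" "hq a b c d $ 4 = d"
  by (simp_all add: hq_def vector_def)

lemma hc_eq_iff: "p = q \<longleftrightarrow> p $ 1 = q $ 1 \<and> p $ 2 = q $ 2 \<and> p $ 3 = q $ 3 \<and> p $ 4 = q $ 4"
  for p q :: hc
  by (simp add: vec_eq_iff forall_4)

lemma qmult_nth [simp]:
  "(p \<odot> q) $ 1 = p$1 * q$1 - p$2 * q$2 - p$3 * q$3 - p$4 * q$4"
  "(p \<odot> q) $ 2 = p$1 * q$2 + p$2 * q$1 + p$3 * q$4 - p$4 * q$3"
  "(p \<odot> q) $ 3 = p$1 * q$3 - p$2 * q$4 + p$3 * q$1 + p$4 * q$2"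
  "(p \<odot> q) $ 4 = p$1 * q$4 + p$2 * q$3 - p$3 * q$2 + p$4 * q$1"
  by (simp_all add: qmult_def)

lemma qconj_nth [simp]:
  "qconj q $ 1 = q$1" "qconj q $ 2 = - q$2" "qconj q $ 3 = - q$3" "qconj q $ 4 = - q$4"
  by (simp_all add: qconj_def)

lemma qhat_nth [simp]: "qhat q $ k = cnj (q $ k)"
  by (simp add: qhat_def)

lemma qone_nth [simp]: "qone $ 1 = 1" "qone $ 2 = 0" "qone $ 3 = 0" "qone $ 4 = 0"
  by (simp_all add: qone_def)

lemma qI_nth [simp]: "qI $ 1 = 0" "qI $ 2 = 1" "qI $ 3 = 0" "qI $ 4 = 0"
  by (simp_all add: qI_def)

lemma qJ_nth [simp]: "qJ $ 1 = 0" "qJ $ 2 = 0" "qJ $ 3 = 1" "qJ $ 4 = 0"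
  by (simp_all add: qJ_def)

lemma qK_nth [simp]: "qK $ 1 = 0" "qK $ 2 = 0" "qK $ 3 = 0" "qK $ 4 = 1"
  by (simp_all add: qK_def)

lemma Hform_eq: "Hform p q = p$1 * q$1 + p$2 * q$2 + p$3 * q$3 + p$4 * q$4"
  by (simp add: Hform_def sum_4)

lemma R31_iff: "q \<in> R31 \<longleftrightarrow> Re (q$1) = 0 \<and> Im (q$2) = 0 \<and> Im (q$3) = 0 \<and> Im (q$4) = 0"
proof
  assume "Re (q$1) = 0 \<and> Im (q$2) = 0 \<and> Im (q$3) = 0 \<and> Im (q$4) = 0"
  then have "q = hq (\<i> * of_real (Im (q$1))) (of_real (Re (q$2))) (of_real (Re (q$3))) (of_real (Re (q$4)))"
    by (simp add: hc_eq_iff complex_eq_iff)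
  then show "q \<in> R31"
    unfolding R31_def by blast
qed (auto simp: R31_def)

text \<open>\<open>qhat\<close> preserves products and \<open>qconj\<close> reverses them, so this
  fixed-point form of \<open>R31\<close> can be pushed through products without expanding
  coefficients.\<close>

lemma R31_iff_qhat: "q \<in> R31 \<longleftrightarrow> qhat (qconj q) = - q"
  by (auto simp: R31_iff hc_eq_iff complex_eq_iff)

section \<open>Identities for the product and the two conjugations\<close>

lemma qmult_assoc: "p \<odot> q \<odot> r = p \<odot> (q \<odot> r)"
  by (simp add: hc_eq_iff algebra_simps)

lemma qone_mult [simp]: "qone \<odot> q = q" "q \<odot> qone = q"
  by (simp_all add: hc_eq_iff)

lemma qconj_mult: "qconj (p \<odot> q) = qconj q \<odot> qconj p"
  by (simp add: hc_eq_iff algebra_simps)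

lemma qhat_mult: "qhat (p \<odot> q) = qhat p \<odot> qhat q"
  by (simp add: hc_eq_iff)

lemma qhat_qhat [simp]: "qhat (qhat q) = q"
  by (simp add: hc_eq_iff)

lemma qconj_qconj [simp]: "qconj (qconj q) = q"
  by (simp add: hc_eq_iff)

lemma qhat_qconj: "qhat (qconj q) = qconj (qhat q)"
  by (simp add: hc_eq_iff)

lemma qhat_diff: "qhat (p - q) = qhat p - qhat q"
  by (simp add: hc_eq_iff)

lemma qconj_diff: "qconj (p - q) = qconj p - qconj q"
  by (simp add: hc_eq_iff)

lemma qmult_qconj_self:
  assumes "Hform q q = 1"
  shows "q \<odot> qconj q = qone" "qconj q \<odot> q = qone"
  using assms by (simp_all add: hc_eq_iff Hform_eq)

lemma Hform_commute: "Hform x y = Hform y x"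
  by (simp add: Hform_eq mult.commute)

text \<open>\<open>Hform\<close> polarises the multiplicative quaternion norm, so multiplication by
  \<open>p\<close> on either side scales it by \<open>Hform p p\<close>. Units therefore act by
  isometries.\<close>

lemma Hform_qmult_left: "Hform (p \<odot> q) (p \<odot> r) = Hform p p * Hform q r"
  by (simp add: Hform_eq algebra_simps)

lemma Hform_qmult_right: "Hform (q \<odot> p) (r \<odot> p) = Hform p p * Hform q r"
  by (simp add: Hform_eq algebra_simps)

lemma Hform_qconj: "Hform (qconj p) (qconj q) = Hform p q"
  by (simp add: Hform_eq)

lemma Hform_qhat: "Hform (qhat p) (qhat q) = cnj (Hform p q)"
  by (simp add: Hform_eq)

text \<open>Only real bilinearity has to be checked, as continuity is automatic in finite dimension.
  The product rule for derivatives rests on this form.\<close>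

lemma bounded_bilinear_qmult: "bounded_bilinear (\<odot>)"
  unfolding bilinear_conv_bounded_bilinear[symmetric] bilinear_def
  by (auto intro!: linearI simp: hc_eq_iff algebra_simps scaleR_conv_of_real [where 'a = complex])

lemma bounded_bilinear_Hform: "bounded_bilinear Hform"
  unfolding bilinear_conv_bounded_bilinear[symmetric] bilinear_def
  by (auto intro!: linearI simp: Hform_eq algebra_simps scaleR_conv_of_real [where 'a = complex])

lemma bounded_linear_qconj: "bounded_linear qconj"
  unfolding linear_conv_bounded_linear[symmetric]
  by (auto intro!: linearI simp: hc_eq_iff)

lemma bounded_linear_qhat: "bounded_linear qhat"
  unfolding linear_conv_bounded_linear[symmetric]
  by (auto intro!: linearI simp: hc_eq_iff)

lemmas qmult_add_left = bounded_bilinear.add_left [OF bounded_bilinear_qmult]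
lemmas qmult_add_right = bounded_bilinear.add_right [OF bounded_bilinear_qmult]
lemmas qmult_diff_left = bounded_bilinear.diff_left [OF bounded_bilinear_qmult]
lemmas qmult_diff_right = bounded_bilinear.diff_right [OF bounded_bilinear_qmult]
lemmas qmult_minus_left = bounded_bilinear.minus_left [OF bounded_bilinear_qmult]
lemmas qmult_minus_right = bounded_bilinear.minus_right [OF bounded_bilinear_qmult]

section \<open>Sandwich products \<open>qconj f \<odot> y \<odot> qhat f\<close> and their
  derivatives\<close>

lemma sandwich_derivative_R31:
  assumes "y \<in> R31"
  shows "qconj n \<odot> y \<odot> qhat f = - qhat (qconj (qconj f \<odot> y \<odot> qhat n))"
    and "qconj n \<odot> y \<odot> qhat f + qconj f \<odot> y \<odot> qhat n \<in> R31"
proof -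
  \<comment> \<open>The map \<open>q \<mapsto> - qhat (qconj q)\<close> reverses the three factors
    and fixes \<open>y\<close>; it turns \<open>qhat n\<close> on the right into
    \<open>qconj n\<close> on the left and \<open>qconj f\<close> on the left into
    \<open>qhat f\<close> on the right.\<close>
  show *: "qconj n \<odot> y \<odot> qhat f = - qhat (qconj (qconj f \<odot> y \<odot> qhat n))"
    using assms
    by (simp add: R31_iff_qhat qconj_mult qhat_mult qmult_assoc qmult_minus_left qmult_minus_right
        flip: qhat_qconj)
  \<comment> \<open>The sum of \<open>z\<close> and its image under an involution is fixed by the
    involution.\<close>
  have "- qhat (qconj z) + z \<in> R31" for z
    by (simp add: R31_iff)
  then show "qconj n \<odot> y \<odot> qhat f + qconj f \<odot> y \<odot> qhat n \<in> R31"
    unfolding * .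
qed

lemma sandwich_R31:
  assumes "y \<in> R31"
  shows "qconj f \<odot> y \<odot> qhat f \<in> R31"
  using assms
  by (simp add: R31_iff_qhat qconj_mult qhat_mult qmult_assoc qmult_minus_left qmult_minus_right
        flip: qhat_qconj)

text \<open>The two outer factors scale \<open>Hform\<close> by \<open>Hform f f\<close> and by its
  complex conjugate, both equal to 1.\<close>

lemma mink_sandwich:
  assumes "Hform f f = 1"
  shows "mink (qconj f \<odot> x \<odot> qhat f) (qconj f \<odot> y \<odot> qhat f) = mink x y"
  using assms by (simp add: mink_def Hform_qmult_left Hform_qmult_right Hform_qconj Hform_qhat)

lemma mink_add_left: "mink (x + y) z = mink x z + mink y z"
  by (simp add: mink_def bounded_bilinear.add_left[OF bounded_bilinear_Hform])

lemma sandwich_trace: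
  assumes y: "y1 \<in> R31" "y2 \<in> R31" and h: "h \<in> R31"
    and dirac: "- (y1 \<odot> qhat n1) + y2 \<odot> qhat n2 = h \<odot> qhat f"
  shows "- (qconj n1 \<odot> y1 \<odot> qhat f + qconj f \<odot> y1 \<odot> qhat n1)
      + (qconj n2 \<odot> y2 \<odot> qhat f + qconj f \<odot> y2 \<odot> qhat n2) = 2 *\<^sub>R (qconj f \<odot> h \<odot> qhat f)"
proof -
  define B where "B = qconj f \<odot> h \<odot> qhat f"
  \<comment> \<open>Left multiplication of the Dirac equation by \<open>qconj f\<close> collects the
    terms with \<open>n1\<close> and \<open>n2\<close> on the right.\<close>
  have B: "B = - (qconj f \<odot> y1 \<odot> qhat n1) + qconj f \<odot> y2 \<odot> qhat n2"
    by (simp add: B_def qmult_assoc flip: dirac qmult_minus_right qmult_add_right)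
  have "- (qconj n1 \<odot> y1 \<odot> qhat f) + qconj n2 \<odot> y2 \<odot> qhat f = - qhat (qconj B)"
    by (simp add: sandwich_derivative_R31(1)[OF y(1), of n1 f] sandwich_derivative_R31(1)[OF y(2), of n2 f]
        B qhat_diff qconj_diff)
  also have "\<dots> = B"
    using sandwich_R31[OF h] by (simp add: R31_iff_qhat B_def)
  \<comment> \<open>One copy of \<open>B\<close> is expanded by its definition through the Dirac
    equation; the other is accounted for by the terms with \<open>n1\<close> and \<open>n2\<close>
    on the left, just computed.\<close>
  finally have "- (qconj n1 \<odot> y1 \<odot> qhat f + qconj f \<odot> y1 \<odot> qhat n1)
      + (qconj n2 \<odot> y2 \<odot> qhat f + qconj f \<odot> y2 \<odot> qhat n2) = B + B"
    by (subst (2) B) (simp add: algebra_simps)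
  then show ?thesis
    by (simp add: B_def scaleR_2)
qed

text \<open>Writing \<open>n\<^sub>j = m\<^sub>j f\<close>, the scalar parts of the \<open>m\<^sub>j\<close> vanish by assumption; the two components of
  the equation outside the span of \<open>J\<close> and \<open>K\<close> force their \<open>I\<close>-parts to vanish as well.\<close>

lemma sandwich_derivative_normal:
  assumes y1: "y1 = hq (\<i> * of_real a1) (of_real b1) 0 0"
    and y2: "y2 = hq (\<i> * of_real a2) (of_real b2) 0 0"
    and det: "a1 * b2 - a2 * b1 \<noteq> 0"
    and h: "h $ 1 = 0" "h $ 2 = 0"
    and f: "Hform f f = 1" and n: "Hform n1 f = 0" "Hform n2 f = 0"
    and dirac: "- (y1 \<odot> qhat n1) + y2 \<odot> qhat n2 = h \<odot> qhat f"
    and u: "u = hq (\<i> * of_real u1) (of_real u2) 0 0"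
  shows "mink (qconj n1 \<odot> y1 \<odot> qhat f + qconj f \<odot> y1 \<odot> qhat n1) (qconj f \<odot> u \<odot> qhat f) = 0"
    and "mink (qconj n2 \<odot> y2 \<odot> qhat f + qconj f \<odot> y2 \<odot> qhat n2) (qconj f \<odot> u \<odot> qhat f) = 0"
proof -
  define m1 where "m1 = n1 \<odot> qconj f"
  define m2 where "m2 = n2 \<odot> qconj f"
  have n_eq: "n1 = m1 \<odot> f" "n2 = m2 \<odot> f"
    by (simp_all add: m1_def m2_def qmult_assoc qmult_qconj_self f)
  have scalar: "m1 $ 1 = 0" "m2 $ 1 = 0"
    using n by (simp_all add: m1_def m2_def Hform_eq)
  \<comment> \<open>Multiplying by the inverse of \<open>qhat f\<close> removes the spinor from the
    Dirac equation and leaves an equation for \<open>m1\<close> and \<open>m2\<close> alone.\<close>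
  have "(- (y1 \<odot> qhat m1) + y2 \<odot> qhat m2) \<odot> (qhat f \<odot> qhat (qconj f)) = h \<odot> (qhat f \<odot> qhat (qconj f))"
    using arg_cong[OF dirac, of "\<lambda>z. z \<odot> qhat (qconj f)"]
    by (simp add: n_eq qhat_mult qmult_assoc qmult_diff_left)
  moreover have "qhat f \<odot> qhat (qconj f) = qone"
    using qmult_qconj_self(1)[OF f] by (simp add: hc_eq_iff flip: qhat_mult)
  ultimately have eq: "- (y1 \<odot> qhat m1) + y2 \<odot> qhat m2 = h"
    by simp
  \<comment> \<open>The 1- and I-components of the equation form a homogeneous linear system for the
    conjugated I-parts of \<open>m1\<close> and \<open>m2\<close>; up to sign its determinant is the
    one in \<open>det\<close>.\<close>
  have e1: "of_real b1 * cnj (m1 $ 2) = of_real b2 * cnj (m2 $ 2)"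
    using arg_cong[OF eq, of "\<lambda>z. z $ 1"] by (simp add: y1 y2 h scalar)
  have e2: "of_real a1 * cnj (m1 $ 2) = of_real a2 * cnj (m2 $ 2)"
    using arg_cong[OF eq, of "\<lambda>z. z $ 2"] by (simp add: y1 y2 h scalar) 
  have "of_real (a1 * b2 - a2 * b1) * cnj (m1 $ 2) = 0" "of_real (a1 * b2 - a2 * b1) * cnj (m2 $ 2) = 0"
    using e1 e2 unfolding of_real_diff of_real_mult by algebra+
  then have I_part: "m1 $ 2 = 0" "m2 $ 2 = 0"
    using det by (simp_all del: of_real_diff of_real_mult)
  \<comment> \<open>If \<open>m\<close> lies in the span of J and K and \<open>y\<close> in that of
    1 and I, then both \<open>qconj m \<odot> y\<close> and \<open>y \<odot> qhat m\<close> lie in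
    the span of J and K, which is orthogonal to \<open>u\<close>.\<close>
  have normal: "mink (qconj (m \<odot> f) \<odot> y \<odot> qhat f + qconj f \<odot> y \<odot> qhat (m \<odot> f)) (qconj f \<odot> u \<odot> qhat f) = 0"
    if "m $ 1 = 0" "m $ 2 = 0" "y $ 3 = 0" "y $ 4 = 0" for m y
  proof -
    have "qconj (m \<odot> f) \<odot> y \<odot> qhat f + qconj f \<odot> y \<odot> qhat (m \<odot> f)
        = qconj f \<odot> (qconj m \<odot> y + y \<odot> qhat m) \<odot> qhat f"
      by (simp add: qconj_mult qhat_mult qmult_assoc qmult_add_left qmult_add_right)
    then have "mink (qconj (m \<odot> f) \<odot> y \<odot> qhat f + qconj f \<odot> y \<odot> qhat (m \<odot> f)) (qconj f \<odot> u \<odot> qhat f)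
        = mink (qconj m \<odot> y + y \<odot> qhat m) u"
      by (simp only: mink_sandwich[OF f])
    also have "\<dots> = 0"
      by (simp add: mink_def Hform_eq u that)
    finally show ?thesis .
  qed
  show "mink (qconj n1 \<odot> y1 \<odot> qhat f + qconj f \<odot> y1 \<odot> qhat n1) (qconj f \<odot> u \<odot> qhat f) = 0"
    unfolding n_eq by (rule normal) (simp_all add: scalar I_part y1)
  show "mink (qconj n2 \<odot> y2 \<odot> qhat f + qconj f \<odot> y2 \<odot> qhat n2) (qconj f \<odot> u \<odot> qhat f) = 0"
    unfolding n_eq by (rule normal) (simp_all add: scalar I_part y2)
qed

text \<open>Here \<open>f'\<close> and \<open>y'\<close> play the ordinary derivatives of a spinor
  coordinate and a tangent vector coordinate, \<open>n\<close> and \<open>z\<close> the covariant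
  ones, \<open>m\<close> and \<open>r\<close> the connection coefficients. The product rule gives
  the same result with either pair, up to moving one term.\<close>

lemma spin_sandwich_derivative:
  assumes f': "f' = n - hq 0 (of_real r - \<i> * of_real m / 2) 0 0 \<odot> f"
    and y: "y = hq (\<i> * of_real y1) (of_real y2) 0 0"
    and y': "y' = z - hq (\<i> * of_real (m * y2)) (of_real (m * y1)) 0 0"
  shows "qconj f' \<odot> y \<odot> qhat f + qconj f \<odot> y' \<odot> qhat f + qconj f \<odot> y \<odot> qhat f'
    = qconj f \<odot> z \<odot> qhat f + (qconj n \<odot> y \<odot> qhat f + qconj f \<odot> y \<odot> qhat n)"
proof -
  define \<eta> where "\<eta> = hq 0 (of_real r - \<i> * of_real m / 2) 0 0"
  have "qconj \<eta> = - \<eta>"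
    by (simp add: \<eta>_def hc_eq_iff)
  then have conj_f': "qconj f' = qconj n + qconj f \<odot> \<eta>"
    by (simp add: f' qconj_diff qconj_mult qmult_minus_right flip: \<eta>_def)
  have hat_f': "qhat f' = qhat n - qhat \<eta> \<odot> qhat f"
    by (simp add: f' qhat_diff qhat_mult flip: \<eta>_def)
  \<comment> \<open>The left side contains the derivative of \<open>spin_cover\<close> along
    \<open>\<eta>\<close>, applied to \<open>y\<close>. As \<open>y\<close> commutes with I, only
    \<open>\<eta> - qhat \<eta> = - \<i> m I\<close> matters: \<open>r\<close> drops out and the
    rest is the boost term removed from \<open>z\<close> in \<open>y'\<close>.\<close>
  have "\<eta> \<odot> y - y \<odot> qhat \<eta> + y' = z"
    by (simp add: y y' \<eta>_def hc_eq_iff algebra_simps)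
  then have "qconj f \<odot> z \<odot> qhat f
      = qconj f \<odot> \<eta> \<odot> y \<odot> qhat f - qconj f \<odot> y \<odot> (qhat \<eta> \<odot> qhat f) + qconj f \<odot> y' \<odot> qhat f"
    by (auto simp: qmult_assoc qmult_add_left qmult_diff_left qmult_add_right qmult_diff_right)
  then show ?thesis
    by (simp add: conj_f' hat_f' qmult_add_left qmult_diff_right algebra_simps)
qed

section \<open>Calculus on surfaces\<close>

lemma Ck_on_subset: "Ck_on n S f \<Longrightarrow> T \<subseteq> S \<Longrightarrow> Ck_on n T f"
  by (induction n arbitrary: f) (auto intro: continuous_on_subset)

lemma frechet_derivative_cong_open:
  assumes "open S" "x \<in> S" "\<And>y. y \<in> S \<Longrightarrow> f y = g y"
  shows "frechet_derivative f (at x) = frechet_derivative g (at x)"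
    and "f differentiable at x \<longleftrightarrow> g differentiable at x"
proof -
  have "(f has_derivative D) (at x) \<longleftrightarrow> (g has_derivative D) (at x)" for D
    using assms by (metis has_derivative_transform_within_open)
  then show "frechet_derivative f (at x) = frechet_derivative g (at x)"
    and "f differentiable at x \<longleftrightarrow> g differentiable at x"
    by (simp_all add: frechet_derivative_def differentiable_def)
qed

lemma Ck_on_cong:
  assumes "open S" "\<And>x. x \<in> S \<Longrightarrow> f x = g x"
  shows "Ck_on n S f \<longleftrightarrow> Ck_on n S g"
  using assms(2)
proof (induction n arbitrary: f g)
  case 0
  then show ?case by (simp cong: continuous_on_cong)
next
  case (Suc n)
  have fg: "f differentiable at x \<longleftrightarrow> g differentiable at x" if "x \<in> S" for x
    using frechet_derivative_cong_open(2)[OF assms(1) that] Suc.prems by blast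
  have "Ck_on n S (\<lambda>x. frechet_derivative f (at x) v) \<longleftrightarrow> Ck_on n S (\<lambda>x. frechet_derivative g (at x) v)" for v
    by (rule Suc.IH) (metis frechet_derivative_cong_open(1)[OF assms(1)] Suc.prems)
  with fg show ?case by simp
qed

lemma Ck_on_lincomb:
  assumes "open S" "Ck_on n S f" "Ck_on n S g"
  shows "Ck_on n S (\<lambda>x. a *\<^sub>R f x + b *\<^sub>R g x)"
  using assms(2,3)
proof (induction n arbitrary: f g)
  case 0
  then show ?case by (auto intro!: continuous_intros)
next
  case (Suc n)
  have D: "((\<lambda>x. a *\<^sub>R f x + b *\<^sub>R g x) has_derivative
      (\<lambda>v. a *\<^sub>R frechet_derivative f (at x) v + b *\<^sub>R frechet_derivative g (at x) v)) (at x)" if "x \<in> S" for x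
  proof -
    have "f differentiable at x" "g differentiable at x"
      using Suc.prems that by simp_all
    then show ?thesis
      unfolding frechet_derivative_works by (intro has_derivative_add has_derivative_scaleR_right)
  qed
  have "Ck_on n S (\<lambda>x. frechet_derivative (\<lambda>x. a *\<^sub>R f x + b *\<^sub>R g x) (at x) v)" for v
  proof -
    have "Ck_on n S (\<lambda>x. a *\<^sub>R frechet_derivative f (at x) v + b *\<^sub>R frechet_derivative g (at x) v)"
      using Suc by simp
    then show ?thesis
      by (rule Ck_on_cong[OF assms(1), THEN iffD1, rotated])
        (simp add: frechet_derivative_at[OF D, symmetric])
  qed
  with D show ?case
    by (auto simp: differentiable_def)
qed

text \<open>The chart that \<open>deriv_along\<close> selects; naming it reduces the rules for
  \<open>deriv_along\<close> to those for a Frechet derivative on the plane.\<close>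

definition chart_at :: "'m chart set \<Rightarrow> 'm \<Rightarrow> 'm chart" where
  "chart_at A p = (SOME k. k \<in> A \<and> p \<in> fst k)"

definition diff_at :: "'m chart set \<Rightarrow> 'm \<Rightarrow> ('m \<Rightarrow> 'b::real_normed_vector) \<Rightarrow> bool" where
  "diff_at A p f \<longleftrightarrow> (f \<circ> chart_inv (chart_at A p)) differentiable at (snd (chart_at A p) p)"

lemma deriv_along_eq:
  "deriv_along A p v f =
     frechet_derivative (f \<circ> chart_inv (chart_at A p)) (at (snd (chart_at A p) p)) (v (chart_at A p))"
  by (simp add: deriv_along_def chart_deriv_def chart_at_def Let_def)

lemma
  assumes "diff_at A p f" and L: "bounded_linear L"
  shows diff_at_linear: "diff_at A p (\<lambda>x. L (f x))"
    and deriv_along_linear: "deriv_along A p v (\<lambda>x. L (f x)) = L (deriv_along A p v f)"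
proof -
  have "(f \<circ> chart_inv (chart_at A p) has_derivative
      frechet_derivative (f \<circ> chart_inv (chart_at A p)) (at (snd (chart_at A p) p)))
      (at (snd (chart_at A p) p))"
    using assms(1) by (simp add: diff_at_def frechet_derivative_works)
  from bounded_linear.has_derivative[OF L this]
  have *: "((\<lambda>x. L (f x)) \<circ> chart_inv (chart_at A p) has_derivative
      (\<lambda>u. L (frechet_derivative (f \<circ> chart_inv (chart_at A p)) (at (snd (chart_at A p) p)) u)))
      (at (snd (chart_at A p) p))"
    by (simp add: o_def)
  show "diff_at A p (\<lambda>x. L (f x))"
    using * by (auto simp: diff_at_def differentiable_def)
  show "deriv_along A p v (\<lambda>x. L (f x)) = L (deriv_along A p v f)"
    using frechet_derivative_at[OF *, symmetric] by (simp add: deriv_along_eq)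
qed

lemma deriv_along_const: "deriv_along A p v (\<lambda>x. c) = 0"
  by (simp add: deriv_along_eq o_def)

section \<open>Smooth maps and smooth sections on a fixed surface\<close>

locale surface =
  fixes A :: "'m::{t2_space,second_countable_topology} chart set"
  assumes smooth_surface: "smooth_surface A"
begin

lemma chart_homeomorphism:
  "k \<in> A \<Longrightarrow> homeomorphism (fst k) (snd k ` fst k) (snd k) (chart_inv k)"
  and chart_open: "k \<in> A \<Longrightarrow> open (fst k)" "k \<in> A \<Longrightarrow> open (snd k ` fst k)"
  using smooth_surface by (auto simp: smooth_surface_def)

lemma chart_inv_chart [simp]: "k \<in> A \<Longrightarrow> x \<in> fst k \<Longrightarrow> chart_inv k (snd k x) = x"
  using chart_homeomorphism by (auto simp: homeomorphism_def)

lemma open_chart_image: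
  assumes "k \<in> A" "open W"
  shows "open (snd k ` (fst k \<inter> W))"
proof -
  have "openin (top_of_set (snd k ` fst k)) (snd k ` (fst k \<inter> W))"
    using assms by (intro homeomorphism_imp_open_map[OF chart_homeomorphism]) (auto simp: openin_open_Int)
  then show ?thesis
    using openin_open_trans chart_open(2)[OF assms(1)] by blast
qed

lemma chart_at: "chart_at A p \<in> A" "p \<in> fst (chart_at A p)"
proof -
  have "\<exists>k. k \<in> A \<and> p \<in> fst k"
    using smooth_surface unfolding smooth_surface_def by (metis UN_E UNIV_I)
  from someI_ex[OF this] show "chart_at A p \<in> A" "p \<in> fst (chart_at A p)"
    by (simp_all add: chart_at_def)
qed

lemma smooth_map_subset:
  "smooth_map A W f \<Longrightarrow> open W' \<Longrightarrow> W' \<subseteq> W \<Longrightarrow> smooth_map A W' f"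
  unfolding smooth_map_def smooth_on_def by (blast intro: Ck_on_subset)

lemma smooth_map_lincomb:
  assumes "smooth_map A W f" "smooth_map A W g"
  shows "smooth_map A W (\<lambda>x. a *\<^sub>R f x + b *\<^sub>R g x)"
proof -
  have W: "open W"
    using assms by (simp add: smooth_map_def)
  have "Ck_on n (snd k ` (fst k \<inter> W)) (\<lambda>x. a *\<^sub>R (f \<circ> chart_inv k) x + b *\<^sub>R (g \<circ> chart_inv k) x)"
    if "k \<in> A" for k n
    using assms that by (intro Ck_on_lincomb open_chart_image W) (auto simp: smooth_map_def smooth_on_def o_def)
  then show ?thesis
    using W by (simp add: smooth_map_def smooth_on_def o_def)
qed

lemma smooth_map_diff_at:
  assumes "smooth_map A W f" "p \<in> W"
  shows "diff_at A p f"
proof -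
  have "Ck_on (Suc 0) (snd (chart_at A p) ` (fst (chart_at A p) \<inter> W)) (f \<circ> chart_inv (chart_at A p))"
    using assms(1) chart_at(1) unfolding smooth_map_def smooth_on_def by blast
  then show ?thesis
    using assms(2) chart_at(2) by (auto simp: diff_at_def)
qed

lemma
  assumes "open W" "p \<in> W" "\<And>x. x \<in> W \<Longrightarrow> f x = g x"
  shows deriv_along_cong: "deriv_along A p v f = deriv_along A p v g"
    and diff_at_cong: "diff_at A p f \<longleftrightarrow> diff_at A p g"
proof -
  note image = open_chart_image[OF chart_at(1) assms(1)]
  have p: "snd (chart_at A p) p \<in> snd (chart_at A p) ` (fst (chart_at A p) \<inter> W)"
    using assms(2) chart_at by blast
  have eq: "(f \<circ> chart_inv (chart_at A p)) y = (g \<circ> chart_inv (chart_at A p)) y"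
    if "y \<in> snd (chart_at A p) ` (fst (chart_at A p) \<inter> W)" for y
    using that assms(3) chart_at by auto
  have "frechet_derivative (f \<circ> chart_inv (chart_at A p)) (at (snd (chart_at A p) p))
      = frechet_derivative (g \<circ> chart_inv (chart_at A p)) (at (snd (chart_at A p) p))"
    by (rule frechet_derivative_cong_open(1)[OF image p eq])
  then show "deriv_along A p v f = deriv_along A p v g"
    by (simp add: deriv_along_eq)
  show "diff_at A p f \<longleftrightarrow> diff_at A p g"
    unfolding diff_at_def by (rule frechet_derivative_cong_open(2)[OF image p eq])
qed

lemma
  assumes "diff_at A p f" "diff_at A p g" and b: "bounded_bilinear b"
  shows diff_at_bilinear: "diff_at A p (\<lambda>x. b (f x) (g x))"
    and deriv_along_bilinear:
      "deriv_along A p v (\<lambda>x. b (f x) (g x)) = b (f p) (deriv_along A p v g) + b (deriv_along A p v f) (g p)"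
proof -
  let ?k = "chart_at A p"
  have "(f \<circ> chart_inv ?k has_derivative frechet_derivative (f \<circ> chart_inv ?k) (at (snd ?k p))) (at (snd ?k p))"
    "(g \<circ> chart_inv ?k has_derivative frechet_derivative (g \<circ> chart_inv ?k) (at (snd ?k p))) (at (snd ?k p))"
    using assms by (simp_all add: diff_at_def frechet_derivative_works)
  from bounded_bilinear.FDERIV[OF b this]
  have *: "((\<lambda>x. b (f x) (g x)) \<circ> chart_inv ?k has_derivative
      (\<lambda>u. b (f p) (frechet_derivative (g \<circ> chart_inv ?k) (at (snd ?k p)) u) +
           b (frechet_derivative (f \<circ> chart_inv ?k) (at (snd ?k p)) u) (g p))) (at (snd ?k p))"
    by (simp add: o_def chart_at)
  show "diff_at A p (\<lambda>x. b (f x) (g x))"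
    using * by (auto simp: diff_at_def differentiable_def)
  show "deriv_along A p v (\<lambda>x. b (f x) (g x)) = b (f p) (deriv_along A p v g) + b (deriv_along A p v f) (g p)"
    using frechet_derivative_at[OF *, symmetric] by (simp add: deriv_along_eq)
qed

lemma deriv_along_add:
  assumes "diff_at A p f" "diff_at A p g"
  shows "deriv_along A p v (\<lambda>x. f x + g x) = deriv_along A p v f + deriv_along A p v g"
    and "diff_at A p (\<lambda>x. f x + g x)"
proof -
  let ?k = "chart_at A p"
  have "(f \<circ> chart_inv ?k has_derivative frechet_derivative (f \<circ> chart_inv ?k) (at (snd ?k p))) (at (snd ?k p))"
    "(g \<circ> chart_inv ?k has_derivative frechet_derivative (g \<circ> chart_inv ?k) (at (snd ?k p))) (at (snd ?k p))"
    using assms by (simp_all add: diff_at_def frechet_derivative_works)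
  from has_derivative_add[OF this]
  have *: "((\<lambda>x. f x + g x) \<circ> chart_inv ?k has_derivative
      (\<lambda>u. frechet_derivative (f \<circ> chart_inv ?k) (at (snd ?k p)) u +
           frechet_derivative (g \<circ> chart_inv ?k) (at (snd ?k p)) u)) (at (snd ?k p))"
    by (simp add: o_def)
  show "deriv_along A p v (\<lambda>x. f x + g x) = deriv_along A p v f + deriv_along A p v g"
    using frechet_derivative_at[OF *, symmetric] by (simp add: deriv_along_eq)
  show "diff_at A p (\<lambda>x. f x + g x)"
    using * by (auto simp: diff_at_def differentiable_def)
qed

lemma smooth_section_subset:
  assumes "smooth_section A B W s" "open W'" "W' \<subseteq> W"
  shows "smooth_section A B W' s"
  unfolding smooth_section_def
proof (intro conjI ballI)
  show "open W'" by fact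
  show "s x \<in> fibre B x" if "x \<in> W'" for x
    using assms that by (auto simp: smooth_section_def)
  fix b assume "b \<in> frames B"
  obtain U b1 b2 where b: "b = (U, b1, b2)"
    by (cases b)
  obtain f1 f2 :: "'m \<Rightarrow> real" where f: "smooth_map A (U \<inter> W) f1" "smooth_map A (U \<inter> W) f2"
      "\<And>x. x \<in> U \<inter> W \<Longrightarrow> s x = f1 x *\<^sub>R b1 x + f2 x *\<^sub>R b2 x"
    using assms(1) \<open>b \<in> frames B\<close> b unfolding smooth_section_def by blast
  \<comment> \<open>The domain \<open>U\<close> of a frame is an arbitrary set here; openness of
    \<open>U \<inter> W\<close> is read off from the smooth coefficient \<open>f1\<close>.\<close>
  have "U \<inter> W' = (U \<inter> W) \<inter> W'"
    using assms(3) by blast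
  moreover have "open (U \<inter> W)"
    using f(1) by (simp add: smooth_map_def)
  ultimately have "open (U \<inter> W')" "U \<inter> W' \<subseteq> U \<inter> W"
    using assms(2) by auto
  with f show "case b of (U, b1, b2) \<Rightarrow> \<exists>f1 f2 :: 'm \<Rightarrow> real.
        smooth_map A (U \<inter> W') f1 \<and> smooth_map A (U \<inter> W') f2 \<and>
        (\<forall>x\<in>U \<inter> W'. s x = f1 x *\<^sub>R b1 x + f2 x *\<^sub>R b2 x)"
    unfolding b prod.case
    by (intro exI[of _ f1] exI[of _ f2]) (auto intro: smooth_map_subset)
qed

lemma smooth_section_lincomb:
  assumes s: "smooth_section A B W s" and t: "smooth_section A B W t"
    and sub: "\<And>x. x \<in> W \<Longrightarrow> subspace (fibre B x)"
  shows "smooth_section A B W (\<lambda>x. a *\<^sub>R s x + b *\<^sub>R t x)"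
  unfolding smooth_section_def
proof (intro conjI ballI)
  show "open W"
    using s by (simp add: smooth_section_def)
  show "a *\<^sub>R s x + b *\<^sub>R t x \<in> fibre B x" if "x \<in> W" for x
    using s t that sub[OF that] by (auto simp: smooth_section_def intro!: subspace_add subspace_scale)
  fix c assume "c \<in> frames B"
  obtain U b1 b2 where c: "c = (U, b1, b2)"
    by (cases c)
  obtain f1 f2 :: "'m \<Rightarrow> real" where f: "smooth_map A (U \<inter> W) f1" "smooth_map A (U \<inter> W) f2"
      "\<And>x. x \<in> U \<inter> W \<Longrightarrow> s x = f1 x *\<^sub>R b1 x + f2 x *\<^sub>R b2 x"
    using s \<open>c \<in> frames B\<close> c unfolding smooth_section_def by blast
  obtain g1 g2 :: "'m \<Rightarrow> real" where g: "smooth_map A (U \<inter> W) g1" "smooth_map A (U \<inter> W) g2"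
      "\<And>x. x \<in> U \<inter> W \<Longrightarrow> t x = g1 x *\<^sub>R b1 x + g2 x *\<^sub>R b2 x"
    using t \<open>c \<in> frames B\<close> c unfolding smooth_section_def by blast
  show "case c of (U, b1, b2) \<Rightarrow> \<exists>f1 f2 :: 'm \<Rightarrow> real.
        smooth_map A (U \<inter> W) f1 \<and> smooth_map A (U \<inter> W) f2 \<and>
        (\<forall>x\<in>U \<inter> W. a *\<^sub>R s x + b *\<^sub>R t x = f1 x *\<^sub>R b1 x + f2 x *\<^sub>R b2 x)"
    unfolding c prod.case
    using smooth_map_lincomb[OF f(1) g(1), of a b] smooth_map_lincomb[OF f(2) g(2), of a b]
    by (intro exI[of _ "\<lambda>x. a *\<^sub>R f1 x + b *\<^sub>R g1 x"] exI[of _ "\<lambda>x. a *\<^sub>R f2 x + b *\<^sub>R g2 x"])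
      (simp add: f g algebra_simps)
qed

end

section \<open>Bundle metrics and orthonormal frames\<close>

lemma is_basis_mem: "is_basis V b1 b2 \<Longrightarrow> b1 \<in> V" "is_basis V b1 b2 \<Longrightarrow> b2 \<in> V"
  by (auto simp: is_basis_def intro: span_base)

lemma is_basis_subspace: "is_basis V b1 b2 \<Longrightarrow> subspace V"
  by (auto simp: is_basis_def)

lemma is_basis_expand:
  assumes "is_basis V b1 b2" "v \<in> V"
  obtains a b where "v = a *\<^sub>R b1 + b *\<^sub>R b2"
proof -
  have "v \<in> span {b1, b2}"
    using assms by (simp add: is_basis_def)
  then obtain a b where "v - a *\<^sub>R b1 = b *\<^sub>R b2"
    by (auto simp: span_insert span_singleton)
  then show ?thesis
    using that[of a b] by (metis add_diff_cancel_left' diff_add_cancel add.commute)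
qed

lemma
  assumes "bundle_metric A B h"
  shows bundle_metric_sym: "u \<in> fibre B p \<Longrightarrow> v \<in> fibre B p \<Longrightarrow> h p u v = h p v u"
    and bundle_metric_left: "u \<in> fibre B p \<Longrightarrow> v \<in> fibre B p \<Longrightarrow> w \<in> fibre B p \<Longrightarrow>
        h p (a *\<^sub>R u + b *\<^sub>R v) w = a * h p u w + b * h p v w"
  using assms unfolding bundle_metric_def by blast+

lemma bundle_metric_right:
  assumes h: "bundle_metric A B h" and sub: "subspace (fibre B p)"
    and mem: "u \<in> fibre B p" "v \<in> fibre B p" "w \<in> fibre B p"
  shows "h p w (a *\<^sub>R u + b *\<^sub>R v) = a * h p w u + b * h p w v"
proof -
  have "a *\<^sub>R u + b *\<^sub>R v \<in> fibre B p"
    using mem sub by (intro subspace_add subspace_scale)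
  then show ?thesis
    using bundle_metric_left[OF h] bundle_metric_sym[OF h] mem by metis
qed

lemma bundle_metric_zero:
  assumes "bundle_metric A B h" "w \<in> fibre B p"
  shows "h p 0 w = 0"
  using bundle_metric_left[OF assms(1), of w p w w 0 0] assms(2) by simp

lemma connection_mem:
  assumes "connection A B nab" "smooth_section A B W s" "p \<in> W" "v \<in> tangent A p"
  shows "nab p v s \<in> fibre B p"
proof -
  have "\<forall>W p s v. smooth_section A B W s \<and> p \<in> W \<and> v \<in> tangent A p \<longrightarrow> nab p v s \<in> fibre B p"
    using assms(1)[unfolded connection_def] by (elim conjE)
  then show ?thesis
    using assms(2-4) by blast
qed

section \<open>Spin structures and their local sections\<close>

lemma
  assumes "spin_structure A B Q G frame_act P" "q \<in> total P"
  shows spin_structure_cover: "cover P q \<in> Q (proj P q)"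
    and spin_structure_act: "g \<in> G \<Longrightarrow> act P q g \<in> total P" "g \<in> G \<Longrightarrow> proj P (act P q g) = proj P q"
      "g \<in> G \<Longrightarrow> cover P (act P q g) = frame_act g (cover P q)"
    and spin_structure_free:
      "q' \<in> total P \<Longrightarrow> proj P q = proj P q' \<Longrightarrow> \<exists>!g. g \<in> G \<and> q' = act P q g"
proof -
  note * = assms(1)[unfolded spin_structure_def]
  have "\<forall>q\<in>total P. cover P q \<in> Q (proj P q)"
    using * by (elim conjE)
  then show "cover P q \<in> Q (proj P q)"
    using assms(2) by blast
  have act: "\<forall>q\<in>total P. \<forall>g\<in>G. act P q g \<in> total P \<and> proj P (act P q g) = proj P q"
    using * by (elim conjE)
  show "act P q g \<in> total P" "proj P (act P q g) = proj P q" if "g \<in> G"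
    using act assms(2) that by blast+
  have "\<forall>q\<in>total P. \<forall>g\<in>G. cover P (act P q g) = frame_act g (cover P q)"
    using * by (elim conjE)
  then show "cover P (act P q g) = frame_act g (cover P q)" if "g \<in> G"
    using assms(2) that by blast
  have "\<forall>q\<in>total P. \<forall>q'\<in>total P. proj P q = proj P q' \<longrightarrow> (\<exists>!g. g \<in> G \<and> q' = act P q g)"
    using * by (elim conjE)
  then show "\<exists>!g. g \<in> G \<and> q' = act P q g" if "q' \<in> total P" "proj P q = proj P q'"
    using assms(2) that by blast
qed

text \<open>The transition functions between trivialising sections still serve after restriction.
  Smaller domains are allowed because sections of the two spin structures must later share one
  domain.\<close>

lemma (in surface) sections_local_section:
  assumes P: "spin_structure A B Q G frame_act P" and s: "(V, s) \<in> sections P" and U: "open U" "U \<subseteq> V"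
  shows "local_section A G P U s"
  unfolding local_section_def
proof (intro conjI)
  note * = P[unfolded spin_structure_def]
  have "\<forall>(U, s)\<in>sections P. open U \<and> (\<forall>x\<in>U. s x \<in> total P \<and> proj P (s x) = x)"
    using * by (elim conjE)
  then show "\<forall>x\<in>U. s x \<in> total P \<and> proj P (s x) = x"
    using s U(2) by blast
  have trans: "\<forall>(U, s)\<in>sections P. \<forall>(V, t)\<in>sections P. \<exists>g. smooth_map A (U \<inter> V) g \<and>
        (\<forall>x\<in>U \<inter> V. g x \<in> G \<and> t x = act P (s x) (g x))"
    using * by (elim conjE)
  show "\<forall>(V, t)\<in>sections P. \<exists>g. smooth_map A (U \<inter> V) g \<and>
        (\<forall>x\<in>U \<inter> V. g x \<in> G \<and> s x = act P (t x) (g x))"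
  proof clarify
    fix W t assume "(W, t) \<in> sections P"
    with trans s obtain g where g: "smooth_map A (W \<inter> V) g" "\<forall>x\<in>W \<inter> V. g x \<in> G \<and> s x = act P (t x) (g x)"
      by blast
    have eq: "U \<inter> W = (W \<inter> V) \<inter> U"
      using U(2) by blast
    have "open (U \<inter> W)"
      unfolding eq using g(1) U(1) by (auto simp: smooth_map_def)
    then have "smooth_map A (U \<inter> W) g"
      by (rule smooth_map_subset[OF g(1)]) (use U(2) in blast)
    with g(2) U(2) show "\<exists>g. smooth_map A (U \<inter> W) g \<and> (\<forall>x\<in>U \<inter> W. g x \<in> G \<and> s x = act P (t x) (g x))"
      by blast
  qed
qed (fact U(1))

section \<open>The spin groups\<close>

lemma Hform_Spin11: "g \<in> Spin11 \<Longrightarrow> Hform g g = 1"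
proof -
  assume "g \<in> Spin11"
  then obtain \<epsilon> s :: real where g: "g = \<epsilon> *\<^sub>R hq (of_real (cosh s)) (\<i> * of_real (sinh s)) 0 0" "\<epsilon> = 1 \<or> \<epsilon> = -1"
    unfolding Spin11_def by blast
  have "cosh s * cosh s - sinh s * sinh s = 1"
    using hyperbolic_pythagoras[of s] by (simp add: power2_eq_square)
  then show ?thesis
    using g(2) by (auto simp: g(1) Hform_eq complex_eq_iff)
qed

lemma Hform_Spin2: "g \<in> Spin2 \<Longrightarrow> Hform g g = 1"
proof -
  assume "g \<in> Spin2"
  then obtain r :: real where g: "g = hq (of_real (cos r)) (of_real (sin r)) 0 0"
    unfolding Spin2_def by blast
  have "cos r * cos r + sin r * sin r = 1"
    using sin_cos_squared_add3[of r] by simp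
  then show ?thesis
    by (simp add: g Hform_eq complex_eq_iff)
qed

text \<open>The entries are the hyperbolic double-angle expressions. Stating this for any point of
  the hyperbola, and not for \<open>cosh\<close> and \<open>sinh\<close>, covers both signs in
  \<open>Spin11\<close> at once.\<close>

lemma frame_act11_eq:
  assumes c: "c\<^sup>2 - s\<^sup>2 = (1::real)" and g: "g = hq (of_real c) (\<i> * of_real s) 0 0"
  shows "frame_act11 g (e1, e2) = ((c\<^sup>2 + s\<^sup>2) *\<^sub>R e1 + (- (2 * c * s)) *\<^sub>R e2, (- (2 * c * s)) *\<^sub>R e1 + (c\<^sup>2 + s\<^sup>2) *\<^sub>R e2)"
proof -
  \<comment> \<open>Both \<open>qhat\<close> and \<open>qconj\<close> negate the coefficient of I in
    \<open>g\<close>, so inverting \<open>qhat g\<close> gives back \<open>g\<close>.\<close>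
  have "Hform (qhat g) (qhat g) = 1"
    using c by (simp add: g Hform_eq power2_eq_square complex_eq_iff)
  then have inv: "qinv (qhat g) = g"
    by (simp add: qinv_def g hc_eq_iff)
  show ?thesis
    unfolding frame_act11_def spin_cover_def inv
    by (simp add: g power2_eq_square algebra_simps flip: scaleR_add_left)
qed

lemma frame_act2_eq:
  assumes c: "c\<^sup>2 + s\<^sup>2 = (1::real)" and g: "g = hq (of_real c) (of_real s) 0 0"
  shows "frame_act2 g (e3, e4) = ((c\<^sup>2 - s\<^sup>2) *\<^sub>R e3 + (2 * c * s) *\<^sub>R e4, (- (2 * c * s)) *\<^sub>R e3 + (c\<^sup>2 - s\<^sup>2) *\<^sub>R e4)"
proof -
  have "Hform (qhat g) (qhat g) = 1"
    using c by (simp add: g Hform_eq power2_eq_square complex_eq_iff)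
  then have inv: "qinv (qhat g) = qconj g"
    by (simp add: qinv_def g hc_eq_iff)
  show ?thesis
    unfolding frame_act2_def spin_cover_def inv
    by (simp add: g power2_eq_square algebra_simps)
qed

section \<open>Spinors and their coordinates\<close>

locale spinor_bundle =
  fixes S :: "('m::{t2_space,second_countable_topology}, 'e::real_vector, 'q1, 'q2) spinor_setting"
  assumes timelike: "timelike_surface S"
    and bundle_E: "riemannian_bundle_E S"
    and spin: "spin_structures S"
begin

sublocale surface "atlas S"
  using timelike by unfold_locales (simp add: timelike_surface_def)

abbreviation "T \<equiv> tangent (atlas S)"

lemma fibre_T [simp]: "fibre (tangent_bundle (atlas S)) = T"
  by (simp add: tangent_bundle_def Let_def)

lemma metric_T: "bundle_metric (atlas S) (tangent_bundle (atlas S)) (metricM S)"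
  using timelike by (simp add: timelike_surface_def lorentzian_def)

lemma metric_E: "bundle_metric (atlas S) (bundleE S) (metricE S)"
  using bundle_E by (simp add: riemannian_bundle_E_def riemannian_def)

lemma connection_T: "connection (atlas S) (tangent_bundle (atlas S)) (nablaM S)"
  and compatible_T: "compatible (atlas S) (tangent_bundle (atlas S)) (metricM S) (nablaM S)"
  using timelike by (simp_all add: timelike_surface_def levi_civita_def)

lemma lorentz_onb: "is_lorentz_onb (atlas S) (metricM S) p (lorentz_onb (atlas S) (metricM S) p)"
  using timelike unfolding timelike_surface_def lorentzian_def lorentz_onb_def by (metis someI_ex)

lemma subspace_T: "subspace (T p)"
  using lorentz_onb[of p] is_basis_subspace by (auto simp: is_lorentz_onb_def split: prod.splits)

lemma subspace_E: "subspace (fibre (bundleE S) p)"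
proof -
  have "p \<in> (\<Union>(U, b1, b2)\<in>frames (bundleE S). U)"
    using bundle_E by (simp add: riemannian_bundle_E_def vector_bundle2_def)
  then obtain U b1 b2 where "(U, b1, b2) \<in> frames (bundleE S)" "p \<in> U"
    by auto
  then have "is_basis (fibre (bundleE S) p) (b1 p) (b2 p)"
    using bundle_E unfolding riemannian_bundle_E_def vector_bundle2_def by blast
  then show ?thesis
    by (rule is_basis_subspace)
qed

lemmas metric_T_left = bundle_metric_left [OF metric_T, unfolded fibre_T]
lemmas metric_T_sym = bundle_metric_sym [OF metric_T, unfolded fibre_T]
lemmas metric_T_right = bundle_metric_right [OF metric_T, unfolded fibre_T, OF subspace_T]

lemma onb_expand:
  assumes onb: "is_lorentz_onb (atlas S) (metricM S) p (e1, e2)" and X: "X \<in> T p"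
  shows "X = (- metricM S p X e1) *\<^sub>R e1 + metricM S p X e2 *\<^sub>R e2"
proof -
  have e: "is_basis (T p) e1 e2" "metricM S p e1 e1 = - 1" "metricM S p e2 e2 = 1" "metricM S p e1 e2 = 0"
    using onb by (auto simp: is_lorentz_onb_def)
  note mem = is_basis_mem[OF e(1)]
  obtain a b where X_eq: "X = a *\<^sub>R e1 + b *\<^sub>R e2"
    using is_basis_expand[OF e(1) X] .
  have "metricM S p e2 e1 = 0"
    using metric_T_sym[of e2 p e1] mem e by simp
  then have "metricM S p X e1 = - a" "metricM S p X e2 = b"
    unfolding X_eq by (simp_all add: metric_T_left mem e)
  then show ?thesis
    by (simp add: X_eq)
qed

lemma metric_expand:
  assumes onb: "is_lorentz_onb (atlas S) (metricM S) p (e1, e2)" and X: "X \<in> T p" and Y: "Y \<in> T p"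
  shows "metricM S p X Y = - metricM S p X e1 * metricM S p Y e1 + metricM S p X e2 * metricM S p Y e2"
proof -
  have e: "e1 \<in> T p" "e2 \<in> T p"
    using onb is_basis_mem by (auto simp: is_lorentz_onb_def)
  have "metricM S p X Y = metricM S p ((- metricM S p X e1) *\<^sub>R e1 + metricM S p X e2 *\<^sub>R e2) Y"
    by (subst (1) onb_expand[OF onb X]) (rule refl)
  also have "\<dots> = - metricM S p X e1 * metricM S p Y e1 + metricM S p X e2 * metricM S p Y e2"
    by (simp only: metric_T_left[OF e Y] metric_T_sym[OF e(1) Y] metric_T_sym[OF e(2) Y])
  finally show ?thesis .
qed

lemma spin_M: "spin_structure (atlas S) (tangent_bundle (atlas S))
       (frames11 (atlas S) (metricM S) (posM S) (futM S)) Spin11 frame_act11 (spinM S)"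
  and spin_E: "spin_structure (atlas S) (bundleE S) (frames2 (metricE S) (posE S)) Spin2 frame_act2 (spinE S)"
  using spin by (simp_all add: spin_structures_def)

lemma cover_M:
  assumes "q \<in> total (spinM S)"
  shows "is_lorentz_onb (atlas S) (metricM S) (proj (spinM S) q) (cover (spinM S) q)"
  using spin_structure_cover[OF spin_M assms] by (simp add: frames11_def)

lemma cover_M_mem:
  assumes "q \<in> total (spinM S)"
  shows "fst (cover (spinM S) q) \<in> T (proj (spinM S) q)" "snd (cover (spinM S) q) \<in> T (proj (spinM S) q)"
  using cover_M[OF assms] is_basis_mem by (auto simp: is_lorentz_onb_def split: prod.splits)

text \<open>\<open>frames2\<close> mentions only orientation and inner products; that the vectors
  lie in the fibre follows from the shape that \<open>orientation\<close> prescribes for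
  \<open>posE\<close>.\<close>

lemma cover_E_mem:
  assumes "q \<in> total (spinE S)"
  shows "fst (cover (spinE S) q) \<in> fibre (bundleE S) (proj (spinE S) q)"
    "snd (cover (spinE S) q) \<in> fibre (bundleE S) (proj (spinE S) q)"
proof -
  let ?p = "proj (spinE S) q"
  obtain e3 e4 where c: "cover (spinE S) q = (e3, e4)"
    by fastforce
  have "cover (spinE S) q \<in> frames2 (metricE S) (posE S) ?p"
    by (rule spin_structure_cover[OF spin_E assms])
  then have pos: "(e3, e4) \<in> posE S ?p"
    by (auto simp: frames2_def c)
  have "orientation (atlas S) (bundleE S) (posE S)"
    using bundle_E by (simp add: riemannian_bundle_E_def)
  then obtain b1 b2 where b: "is_basis (fibre (bundleE S) ?p) b1 b2"
      "posE S ?p = {(a *\<^sub>R b1 + b *\<^sub>R b2, c *\<^sub>R b1 + d *\<^sub>R b2) | a b c d :: real. a * d - b * c > 0}"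
    unfolding orientation_def by meson
  have "a *\<^sub>R b1 + b *\<^sub>R b2 \<in> fibre (bundleE S) ?p" for a b
    using is_basis_mem[OF b(1)] subspace_E by (intro subspace_add subspace_scale)
  then show "fst (cover (spinE S) q) \<in> fibre (bundleE S) ?p" "snd (cover (spinE S) q) \<in> fibre (bundleE S) ?p"
    using pos unfolding b(2) c by auto
qed

section \<open>Vector coordinates, changes of frame and spinor representatives\<close>

lemma vec_coord_eq:
  "vec_coord S q1 q2 (X, Y) =
     hq (- \<i> * of_real (metricM S (proj (spinM S) q1) X (fst (cover (spinM S) q1))))
        (of_real (metricM S (proj (spinM S) q1) X (snd (cover (spinM S) q1))))
        (of_real (metricE S (proj (spinM S) q1) Y (fst (cover (spinE S) q2))))
        (of_real (metricE S (proj (spinM S) q1) Y (snd (cover (spinE S) q2))))"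
  by (simp add: vec_coord_def Let_def split: prod.splits)

lemma vec_coord_R31: "vec_coord S q1 q2 Z \<in> R31"
  by (cases Z) (simp add: vec_coord_eq R31_iff)

text \<open>This says that \<open>spin_cover g\<close> maps the new coordinates to the old ones,
  with the inverse cleared. The J- and K-components do not change: \<open>g\<close> passes across J
  and K as \<open>qhat g\<close>.\<close>

lemma vec_coord_act_M:
  assumes q: "q1 \<in> total (spinM S)" and g: "g \<in> Spin11" and X: "X \<in> T (proj (spinM S) q1)"
  shows "g \<odot> vec_coord S (act (spinM S) q1 g) q2 (X, Y) = vec_coord S q1 q2 (X, Y) \<odot> qhat g"
proof -
  obtain \<epsilon> r :: real where \<epsilon>: "g = \<epsilon> *\<^sub>R hq (of_real (cosh r)) (\<i> * of_real (sinh r)) 0 0" "\<epsilon> = 1 \<or> \<epsilon> = -1"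
    using g unfolding Spin11_def by blast
  \<comment> \<open>The sign is absorbed into \<open>c\<close> and \<open>s\<close>, which remain on
    the hyperbola since its square is 1.\<close>
  define c where "c = \<epsilon> * cosh r"
  define s where "s = \<epsilon> * sinh r"
  have g_eq: "g = hq (of_real c) (\<i> * of_real s) 0 0"
    by (simp add: \<epsilon>(1) c_def s_def hc_eq_iff scaleR_conv_of_real[where 'a = complex])
  have cs: "c\<^sup>2 - s\<^sup>2 = 1"
    using \<epsilon>(2) by (auto simp: c_def s_def power_mult_distrib hyperbolic_pythagoras)
  obtain e1 e2 where e: "cover (spinM S) q1 = (e1, e2)"
    by fastforce
  have e_mem: "e1 \<in> T (proj (spinM S) q1)" "e2 \<in> T (proj (spinM S) q1)"
    using cover_M_mem[OF q] by (simp_all add: e)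
  have act: "cover (spinM S) (act (spinM S) q1 g) = frame_act11 g (e1, e2)"
      "proj (spinM S) (act (spinM S) q1 g) = proj (spinM S) q1"
    using spin_structure_act[OF spin_M q g] by (simp_all add: e)
  define k where "k = c\<^sup>2 + s\<^sup>2"
  define l where "l = - (2 * c * s)"
  define x1 where "x1 = metricM S (proj (spinM S) q1) X e1"
  define x2 where "x2 = metricM S (proj (spinM S) q1) X e2"
  have "cover (spinM S) (act (spinM S) q1 g) = (k *\<^sub>R e1 + l *\<^sub>R e2, l *\<^sub>R e1 + k *\<^sub>R e2)"
    unfolding act(1) k_def l_def by (rule frame_act11_eq[OF cs g_eq])
  then have coord: "vec_coord S (act (spinM S) q1 g) q2 (X, Y) $ 1 = - \<i> * of_real (k * x1 + l * x2)"
    "vec_coord S (act (spinM S) q1 g) q2 (X, Y) $ 2 = of_real (l * x1 + k * x2)"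
    "vec_coord S (act (spinM S) q1 g) q2 (X, Y) $ 3 = vec_coord S q1 q2 (X, Y) $ 3"
    "vec_coord S (act (spinM S) q1 g) q2 (X, Y) $ 4 = vec_coord S q1 q2 (X, Y) $ 4"
    "vec_coord S q1 q2 (X, Y) $ 1 = - \<i> * of_real x1"
    "vec_coord S q1 q2 (X, Y) $ 2 = of_real x2"
    by (simp_all add: vec_coord_eq act e metric_T_right e_mem X x1_def x2_def)
  \<comment> \<open>Up to the common sign these are the subtraction formulas for \<open>cosh\<close>
    and \<open>sinh\<close> at a doubled and a single argument.\<close>
  have kl: "c * k + s * l = c" "c * l + s * k = - s"
    unfolding k_def l_def using cs by algebra+
  have "c * (k * x1 + l * x2) + s * (l * x1 + k * x2) = (c * k + s * l) * x1 + (c * l + s * k) * x2"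
    "c * (l * x1 + k * x2) + s * (k * x1 + l * x2) = (c * l + s * k) * x1 + (c * k + s * l) * x2"
    by algebra+
  then show ?thesis
    unfolding kl hc_eq_iff qmult_nth coord
    unfolding g_eq hq_nth qhat_nth by (simp add: complex_eq_iff algebra_simps)
qed

text \<open>Dually to the tangential case, 1 and I commute with \<open>g = qhat g\<close>, while the
  J- and K-components rotate by the double angle.\<close>

lemma vec_coord_act_E:
  assumes q: "q2 \<in> total (spinE S)" "proj (spinE S) q2 = proj (spinM S) q1"
    and g: "g \<in> Spin2" and Y: "Y \<in> fibre (bundleE S) (proj (spinM S) q1)"
  shows "g \<odot> vec_coord S q1 (act (spinE S) q2 g) (X, Y) = vec_coord S q1 q2 (X, Y) \<odot> qhat g"
proof -
  obtain r :: real where r: "g = hq (of_real (cos r)) (of_real (sin r)) 0 0"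
    using g unfolding Spin2_def by blast
  define c where "c = cos r"
  define s where "s = sin r"
  have g_eq: "g = hq (of_real c) (of_real s) 0 0"
    by (simp add: r c_def s_def)
  have cs: "c\<^sup>2 + s\<^sup>2 = 1"
    by (simp add: c_def s_def)
  obtain e3 e4 where e: "cover (spinE S) q2 = (e3, e4)"
    by fastforce
  have e_mem: "e3 \<in> fibre (bundleE S) (proj (spinM S) q1)" "e4 \<in> fibre (bundleE S) (proj (spinM S) q1)"
    using cover_E_mem[OF q(1)] by (simp_all add: e q(2))
  have act: "cover (spinE S) (act (spinE S) q2 g) = frame_act2 g (e3, e4)"
    using spin_structure_act[OF spin_E q(1) g] by (simp add: e)
  define k where "k = c\<^sup>2 - s\<^sup>2"
  define l where "l = 2 * c * s"
  define y3 where "y3 = metricE S (proj (spinM S) q1) Y e3"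
  define y4 where "y4 = metricE S (proj (spinM S) q1) Y e4"
  have "cover (spinE S) (act (spinE S) q2 g) = (k *\<^sub>R e3 + l *\<^sub>R e4, (- l) *\<^sub>R e3 + k *\<^sub>R e4)"
    unfolding act k_def l_def by (rule frame_act2_eq[OF cs g_eq])
  then have coord: "vec_coord S q1 (act (spinE S) q2 g) (X, Y) $ 3 = of_real (k * y3 + l * y4)"
    "vec_coord S q1 (act (spinE S) q2 g) (X, Y) $ 4 = of_real (- l * y3 + k * y4)"
    "vec_coord S q1 (act (spinE S) q2 g) (X, Y) $ 1 = vec_coord S q1 q2 (X, Y) $ 1"
    "vec_coord S q1 (act (spinE S) q2 g) (X, Y) $ 2 = vec_coord S q1 q2 (X, Y) $ 2"
    "vec_coord S q1 q2 (X, Y) $ 3 = of_real y3"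
    "vec_coord S q1 q2 (X, Y) $ 4 = of_real y4"
    by (simp_all add: vec_coord_eq e bundle_metric_right[OF metric_E subspace_E] e_mem Y y3_def y4_def
        del: scaleR_minus_left)
  have kl: "c * k + s * l = c" "c * l - s * k = s"
    unfolding k_def l_def using cs by algebra+
  have "c * (k * y3 + l * y4) - s * (- l * y3 + k * y4) = (c * k + s * l) * y3 + (c * l - s * k) * y4"
    "c * (- l * y3 + k * y4) + s * (k * y3 + l * y4) = (c * k + s * l) * y4 - (c * l - s * k) * y3"
    by algebra+
  then show ?thesis
    unfolding kl hc_eq_iff qmult_nth coord
    unfolding g_eq hq_nth qhat_nth by (simp add: complex_eq_iff algebra_simps)
qed

text \<open>Well-definedness: two representatives differ by \<open>g = g1 \<odot> g2\<close> of norm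
  1, which preserves \<open>Hform\<close> and cancels in the sandwich against the change of vector
  coordinates. Uniqueness of the coordinate comes from freeness of the two actions.\<close>

lemma spinor_class_rep:
  assumes q: "q1 \<in> total (spinM S)" "proj (spinM S) q1 = p" "q2 \<in> total (spinE S)" "proj (spinE S) q2 = p"
    and rep: "(q1', q2', \<zeta>) \<in> spinor_class S q1 q2 \<xi>"
  shows "Hform \<zeta> \<zeta> = Hform \<xi> \<xi>"
    and "X \<in> T p \<Longrightarrow> Y \<in> fibre (bundleE S) p \<Longrightarrow>
      qconj \<zeta> \<odot> vec_coord S q1' q2' (X, Y) \<odot> qhat \<zeta> = qconj \<xi> \<odot> vec_coord S q1 q2 (X, Y) \<odot> qhat \<xi>"
    and "(q1', q2', \<zeta>') \<in> spinor_class S q1 q2 \<xi> \<Longrightarrow> \<zeta>' = \<zeta>"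
proof -
  obtain g1 g2 where g: "q1' = act (spinM S) q1 g1" "q2' = act (spinE S) q2 g2" "g1 \<in> Spin11" "g2 \<in> Spin2"
      "g1 \<odot> g2 \<odot> \<zeta> = \<xi>"
    using rep unfolding spinor_class_def by blast
  define g where "g = g1 \<odot> g2"
  have \<xi>: "\<xi> = g \<odot> \<zeta>"
    by (simp add: g_def g)
  have Hg: "Hform g g = 1"
    using Hform_Spin11[OF g(3)] Hform_Spin2[OF g(4)] by (simp add: g_def Hform_qmult_left)
  have q': "q1' \<in> total (spinM S)" "proj (spinM S) q1' = p" "q2' \<in> total (spinE S)" "proj (spinE S) q2' = p"
    using spin_structure_act[OF spin_M q(1) g(3)] spin_structure_act[OF spin_E q(3) g(4)] q g by simp_all
  show "Hform \<zeta> \<zeta> = Hform \<xi> \<xi>"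
    by (simp add: \<xi> Hform_qmult_left Hform_qmult_right Hg)
  show "qconj \<zeta> \<odot> vec_coord S q1' q2' (X, Y) \<odot> qhat \<zeta> = qconj \<xi> \<odot> vec_coord S q1 q2 (X, Y) \<odot> qhat \<xi>"
    if "X \<in> T p" "Y \<in> fibre (bundleE S) p"
  proof -
    \<comment> \<open>The frames of the tangent bundle and of the normal bundle are changed one
      after the other.\<close>
    have 1: "g1 \<odot> vec_coord S q1' q2 (X, Y) = vec_coord S q1 q2 (X, Y) \<odot> qhat g1"
      unfolding g using q g that by (intro vec_coord_act_M) auto
    have 2: "g2 \<odot> vec_coord S q1' q2' (X, Y) = vec_coord S q1' q2 (X, Y) \<odot> qhat g2"
      unfolding g(2) using q' q g that by (intro vec_coord_act_E) auto
    have "g \<odot> vec_coord S q1' q2' (X, Y) = (g1 \<odot> vec_coord S q1' q2 (X, Y)) \<odot> qhat g2"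
      by (simp add: g_def qmult_assoc 2)
    also have "\<dots> = vec_coord S q1 q2 (X, Y) \<odot> qhat g"
      by (simp add: 1 g_def qmult_assoc qhat_mult)
    finally have "qconj g \<odot> (vec_coord S q1 q2 (X, Y) \<odot> qhat g) = (qconj g \<odot> g) \<odot> vec_coord S q1' q2' (X, Y)"
      by (simp add: qmult_assoc)
    then have "qconj g \<odot> (vec_coord S q1 q2 (X, Y) \<odot> qhat g) = vec_coord S q1' q2' (X, Y)"
      by (simp add: qmult_qconj_self[OF Hg])
    from this[symmetric] show ?thesis
      by (simp add: \<xi> qconj_mult qhat_mult qmult_assoc)
  qed
  show "\<zeta>' = \<zeta>" if rep': "(q1', q2', \<zeta>') \<in> spinor_class S q1 q2 \<xi>"
  proof -
    obtain h1 h2 where h: "q1' = act (spinM S) q1 h1" "q2' = act (spinE S) q2 h2" "h1 \<in> Spin11" "h2 \<in> Spin2"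
        "h1 \<odot> h2 \<odot> \<zeta>' = \<xi>"
      using rep' unfolding spinor_class_def by blast
    have "h1 = g1"
      using spin_structure_free[OF spin_M q(1) q'(1)] q q' g(1,3) h(1,3) by auto
    moreover have "h2 = g2"
      using spin_structure_free[OF spin_E q(3) q'(3)] q q' g(2,4) h(2,4) by auto
    ultimately have "g \<odot> \<zeta>' = g \<odot> \<zeta>"
      using h(5) \<xi> by (simp add: g_def)
    then have "(qconj g \<odot> g) \<odot> \<zeta>' = (qconj g \<odot> g) \<odot> \<zeta>"
      by (simp add: qmult_assoc)
    then show ?thesis
      by (simp add: qmult_qconj_self[OF Hg])
  qed
qed

lemma spinor_class_ex:
  assumes "q1 \<in> total (spinM S)" "q2 \<in> total (spinE S)" "q1' \<in> total (spinM S)" "q2' \<in> total (spinE S)"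
    "proj (spinM S) q1 = proj (spinM S) q1'" "proj (spinE S) q2 = proj (spinE S) q2'"
  shows "\<exists>\<zeta>. (q1', q2', \<zeta>) \<in> spinor_class S q1 q2 \<xi>"
proof -
  obtain g1 where g1: "g1 \<in> Spin11" "q1' = act (spinM S) q1 g1"
    using spin_structure_free[OF spin_M assms(1,3,5)] by blast
  obtain g2 where g2: "g2 \<in> Spin2" "q2' = act (spinE S) q2 g2"
    using spin_structure_free[OF spin_E assms(2,4,6)] by blast
  \<comment> \<open>The witness is the inverse of \<open>g1 \<odot> g2\<close> applied to
    \<open>\<xi>\<close>; elements of norm 1 are inverted by \<open>qconj\<close>.\<close>
  have "g1 \<odot> g2 \<odot> (qconj g2 \<odot> qconj g1 \<odot> \<xi>) = g1 \<odot> ((g2 \<odot> qconj g2) \<odot> (qconj g1 \<odot> \<xi>))"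
    by (simp only: qmult_assoc)
  also have "\<dots> = (g1 \<odot> qconj g1) \<odot> \<xi>"
    by (simp add: qmult_qconj_self[OF Hform_Spin2[OF g2(1)]] qmult_assoc)
  finally have "g1 \<odot> g2 \<odot> (qconj g2 \<odot> qconj g1 \<odot> \<xi>) = \<xi>"
    by (simp add: qmult_qconj_self[OF Hform_Spin11[OF g1(1)]])
  with g1 g2 show ?thesis
    unfolding spinor_class_def by blast
qed

text \<open>These rules replace the definite descriptions in \<open>coord\<close>,
  \<open>spinor_H\<close> and \<open>spinor_pair\<close> by formulas in whatever frame is at
  hand.\<close>

lemma
  assumes "\<psi> \<in> spinors S p"
    and q: "q1 \<in> total (spinM S)" "proj (spinM S) q1 = p" "q2 \<in> total (spinE S)" "proj (spinE S) q2 = p"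
  shows coord_mem: "(q1, q2, coord \<psi> q1 q2) \<in> \<psi>"
    and coord_unique: "(q1, q2, \<zeta>) \<in> \<psi> \<Longrightarrow> \<zeta> = coord \<psi> q1 q2"
    and spinor_H_eq: "spinor_H \<psi> \<psi> = Hform (coord \<psi> q1 q2) (coord \<psi> q1 q2)"
    and spinor_pair_clifford: "X \<in> T p \<Longrightarrow> Y \<in> fibre (bundleE S) p \<Longrightarrow>
      spinor_pair (clifford S (X, Y) \<psi>) \<psi> =
        qconj (coord \<psi> q1 q2) \<odot> vec_coord S q1 q2 (X, Y) \<odot> qhat (coord \<psi> q1 q2)"
proof -
  obtain r1 r2 \<xi> where r: "r1 \<in> total (spinM S)" "proj (spinM S) r1 = p" "r2 \<in> total (spinE S)"
      "proj (spinE S) r2 = p" and \<psi>: "\<psi> = spinor_class S r1 r2 \<xi>"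
    using assms(1) unfolding spinors_def by blast
  note rep = spinor_class_rep[OF r, of _ _ _ \<xi>, folded \<psi>]
  obtain \<zeta>0 where \<zeta>0: "(q1, q2, \<zeta>0) \<in> \<psi>"
    using spinor_class_ex[of r1 r2 q1 q2 \<xi>] q r unfolding \<psi> by auto
  have coord: "coord \<psi> q1 q2 = \<zeta>0"
    unfolding coord_def using \<zeta>0 rep(3)[OF \<zeta>0] by (rule the_equality)
  show mem: "(q1, q2, coord \<psi> q1 q2) \<in> \<psi>"
    using \<zeta>0 by (simp add: coord)
  show "\<zeta> = coord \<psi> q1 q2" if "(q1, q2, \<zeta>) \<in> \<psi>"
    using rep(3)[OF mem that] .
  show "spinor_H \<psi> \<psi> = Hform (coord \<psi> q1 q2) (coord \<psi> q1 q2)"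
    unfolding spinor_H_def
  proof (rule the_equality)
    show "\<forall>q1' q2' \<zeta> \<zeta>'. (q1', q2', \<zeta>) \<in> \<psi> \<and> (q1', q2', \<zeta>') \<in> \<psi> \<longrightarrow>
        Hform (coord \<psi> q1 q2) (coord \<psi> q1 q2) = Hform \<zeta> \<zeta>'"
      using rep(1,3) mem by metis
  qed (use mem in blast)
  show "spinor_pair (clifford S (X, Y) \<psi>) \<psi> =
        qconj (coord \<psi> q1 q2) \<odot> vec_coord S q1 q2 (X, Y) \<odot> qhat (coord \<psi> q1 q2)" (is "_ = ?v")
    if XY: "X \<in> T p" "Y \<in> fibre (bundleE S) p"
    unfolding spinor_pair_def
  proof (rule the_equality)
    show "\<forall>q1' q2' \<zeta> \<zeta>'. (q1', q2', \<zeta>) \<in> clifford S (X, Y) \<psi> \<and> (q1', q2', \<zeta>') \<in> \<psi> \<longrightarrow> ?v = qconj \<zeta>' \<odot> \<zeta>"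
    proof (intro allI impI, elim conjE)
      fix q1' q2' \<zeta> \<zeta>'
      assume *: "(q1', q2', \<zeta>) \<in> clifford S (X, Y) \<psi>" "(q1', q2', \<zeta>') \<in> \<psi>"
      then obtain \<zeta>'' where "(q1', q2', \<zeta>'') \<in> \<psi>" "\<zeta> = vec_coord S q1' q2' (X, Y) \<odot> qhat \<zeta>''"
        unfolding clifford_def by blast
      \<comment> \<open>Over a fixed pair of frames the coordinate is unique, so both arguments of
        the pairing involve the same quaternion.\<close>
      moreover from this *(2) have "\<zeta>'' = \<zeta>'"
        using rep(3) by blast
      ultimately show "?v = qconj \<zeta>' \<odot> \<zeta>"
        using rep(2)[OF *(2) XY] rep(2)[OF mem XY] by (simp add: qmult_assoc)
    qed
    have "(q1, q2, vec_coord S q1 q2 (X, Y) \<odot> qhat (coord \<psi> q1 q2)) \<in> clifford S (X, Y) \<psi>"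
      using mem unfolding clifford_def by blast
    then show "z = ?v" if "\<forall>q1' q2' \<zeta> \<zeta>'. (q1', q2', \<zeta>) \<in> clifford S (X, Y) \<psi> \<and> (q1', q2', \<zeta>') \<in> \<psi>
        \<longrightarrow> z = qconj \<zeta>' \<odot> \<zeta>" for z
      using that mem by (simp add: qmult_assoc)
  qed
qed

text \<open>Trivialising sections are used because \<open>spin_structure\<close> provides smooth
  frames for them; their domains are intersected.\<close>

lemma local_frame_ex:
  obtains U s1 s2 where "p \<in> U" "local_section (atlas S) Spin11 (spinM S) U s1"
    "local_section (atlas S) Spin2 (spinE S) U s2"
    "smooth_section (atlas S) (tangent_bundle (atlas S)) U (\<lambda>x. fst (cover (spinM S) (s1 x)))"
    "smooth_section (atlas S) (tangent_bundle (atlas S)) U (\<lambda>x. snd (cover (spinM S) (s1 x)))"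
proof -
  note M = spin_M[unfolded spin_structure_def] and E = spin_E[unfolded spin_structure_def]
  have "(\<Union>(U, s)\<in>sections (spinM S). U) = UNIV"
    using M by (elim conjE)
  then have "p \<in> (\<Union>(U, s)\<in>sections (spinM S). U)"
    by simp
  then obtain U1 s1 where s1: "(U1, s1) \<in> sections (spinM S)" "p \<in> U1"
    by auto
  have "(\<Union>(U, s)\<in>sections (spinE S). U) = UNIV"
    using E by (elim conjE)
  then have "p \<in> (\<Union>(U, s)\<in>sections (spinE S). U)"
    by simp
  then obtain U2 s2 where s2: "(U2, s2) \<in> sections (spinE S)" "p \<in> U2"
    by auto
  have "\<forall>(U, s)\<in>sections (spinM S). open U \<and> (\<forall>x\<in>U. s x \<in> total (spinM S) \<and> proj (spinM S) (s x) = x)"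
    using M by (elim conjE)
  then have "open U1"
    using s1 by blast
  have "\<forall>(U, s)\<in>sections (spinE S). open U \<and> (\<forall>x\<in>U. s x \<in> total (spinE S) \<and> proj (spinE S) (s x) = x)"
    using E by (elim conjE)
  then have "open U2"
    using s2 by blast
  have "\<forall>(U, s)\<in>sections (spinM S).
        smooth_section (atlas S) (tangent_bundle (atlas S)) U (\<lambda>x. fst (cover (spinM S) (s x))) \<and>
        smooth_section (atlas S) (tangent_bundle (atlas S)) U (\<lambda>x. snd (cover (spinM S) (s x)))"
    using M by (elim conjE)
  then have e: "smooth_section (atlas S) (tangent_bundle (atlas S)) U1 (\<lambda>x. fst (cover (spinM S) (s1 x)))"
        "smooth_section (atlas S) (tangent_bundle (atlas S)) U1 (\<lambda>x. snd (cover (spinM S) (s1 x)))"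
    using s1 by blast+
  have U: "open (U1 \<inter> U2)"
    using \<open>open U1\<close> \<open>open U2\<close> by blast
  show thesis
  proof (rule that[of "U1 \<inter> U2" s1 s2])
    show "local_section (atlas S) Spin11 (spinM S) (U1 \<inter> U2) s1"
      using sections_local_section[OF spin_M s1(1) U] by blast
    show "local_section (atlas S) Spin2 (spinE S) (U1 \<inter> U2) s2"
      using sections_local_section[OF spin_E s2(1) U] by blast
  qed (use s1 s2 smooth_section_subset[OF e(1) U] smooth_section_subset[OF e(2) U] in auto)
qed

end

section \<open>The Hessian of the immersion\<close>

locale spinor_immersion = spinor_bundle S
  for S :: "('m::{t2_space,second_countable_topology}, 'e::real_vector, 'q1, 'q2) spinor_setting" +
  fixes \<phi> :: "'m \<Rightarrow> ('q1, 'q2) spinor" and F :: "'m \<Rightarrow> hc"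
  assumes smooth_\<phi>: "smooth_spinor S \<phi>"
    and norm_\<phi>: "spinor_H (\<phi> x) (\<phi> x) = 1"
    and immersion: "isometric_immersion (atlas S) (metricM S) F"
    and differential_F: "X \<in> T x \<Longrightarrow> differential (atlas S) F x X = xi S \<phi> x (X, 0)"
begin

lemma mink_differential:
  "v \<in> T x \<Longrightarrow> w \<in> T x \<Longrightarrow> mink (differential (atlas S) F x v) (differential (atlas S) F x w) = metricM S x v w"
  using immersion by (simp add: isometric_immersion_def pullback_metric_def)

text \<open>\<open>mean_curvature\<close> chooses its basis from the pullback metric and
  \<open>laplacian\<close> from \<open>metricM\<close>. The two conditions on a basis are
  equivalent, so both choices return the same basis.\<close>

lemma lorentz_onb_pullback: "lorentz_onb (atlas S) (pullback_metric (atlas S) F) x = lorentz_onb (atlas S) (metricM S) x"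
proof -
  have "is_lorentz_onb (atlas S) (pullback_metric (atlas S) F) x e \<longleftrightarrow> is_lorentz_onb (atlas S) (metricM S) x e" for e
    using is_basis_mem[of "T x"] mink_differential
    by (auto simp: is_lorentz_onb_def pullback_metric_def)
  then show ?thesis
    by (simp add: lorentz_onb_def)
qed

text \<open>Two decompositions have tangential parts with equal products against every tangent
  vector; nondegeneracy, in the form of the orthonormal expansion, makes them equal.\<close>

lemma normal_part_eq:
  assumes n: "n \<in> R31" "\<And>w. w \<in> T x \<Longrightarrow> mink n (differential (atlas S) F x w) = 0" and u: "u \<in> T x"
  shows "normal_part (atlas S) F x (differential (atlas S) F x u + n) = n"
  unfolding normal_part_def
proof (rule the_equality)
  let ?d = "differential (atlas S) F x"
  fix n' assume n': "n' \<in> R31 \<and> (\<forall>w\<in>T x. mink n' (?d w) = 0) \<and> (\<exists>u'\<in>T x. ?d u + n = ?d u' + n')"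
  then obtain u' where u': "u' \<in> T x" "?d u + n = ?d u' + n'"
    by blast
  have metric_eq: "metricM S x u w = metricM S x u' w" if w: "w \<in> T x" for w
  proof -
    have "mink (?d u) (?d w) + mink n (?d w) = mink (?d u') (?d w) + mink n' (?d w)"
      using u'(2) by (simp flip: mink_add_left)
    then show ?thesis
      using n(2)[OF w] n' w u u'(1) by (simp add: mink_differential)
  qed
  obtain a b where onb: "is_lorentz_onb (atlas S) (metricM S) x (a, b)"
    using lorentz_onb[of x] by (cases "lorentz_onb (atlas S) (metricM S) x") simp
  then have "a \<in> T x" "b \<in> T x"
    using is_basis_mem by (auto simp: is_lorentz_onb_def)
  then have "u = u'"
    using onb_expand[OF onb u] onb_expand[OF onb u'(1)] metric_eq by metis
  then show "n' = n"
    using u'(2) by simp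
qed (use assms in blast)

end

section \<open>Computation in a local spin frame around a point\<close>

locale spinor_frame = spinor_immersion S \<phi> F
  for S :: "('m::{t2_space,second_countable_topology}, 'e::real_vector, 'q1, 'q2) spinor_setting"
    and \<phi> :: "'m \<Rightarrow> ('q1, 'q2) spinor" and F :: "'m \<Rightarrow> hc" +
  fixes p :: 'm and U s1 s2
  assumes p: "p \<in> U"
    and s1: "local_section (atlas S) Spin11 (spinM S) U s1"
    and s2: "local_section (atlas S) Spin2 (spinE S) U s2"
    and smooth_e1: "smooth_section (atlas S) (tangent_bundle (atlas S)) U (\<lambda>x. fst (cover (spinM S) (s1 x)))"
    and smooth_e2: "smooth_section (atlas S) (tangent_bundle (atlas S)) U (\<lambda>x. snd (cover (spinM S) (s1 x)))"
begin

definition f where "f x = coord (\<phi> x) (s1 x) (s2 x)"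
definition e1 where "e1 x = fst (cover (spinM S) (s1 x))"
definition e2 where "e2 x = snd (cover (spinM S) (s1 x))"

text \<open>The coordinate of \<open>\<nabla>\<^sub>v \<phi>\<close>.\<close>

definition nabla_f where
  "nabla_f v = deriv_along (atlas S) p v f + spin_form S s1 s2 p v \<odot> f p"

definition rot where "rot v = metricM S p (nablaM S p v e1) (e2 p)"

lemma open_U: "open U"
  using s1 by (simp add: local_section_def)

lemma over:
  assumes "x \<in> U"
  shows "s1 x \<in> total (spinM S)" "proj (spinM S) (s1 x) = x" "s2 x \<in> total (spinE S)" "proj (spinE S) (s2 x) = x"
  using s1 s2 assms by (auto simp: local_section_def)

lemma smooth_f: "smooth_map (atlas S) U f"
  using smooth_\<phi> s1 s2 unfolding smooth_spinor_def f_def by blast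

lemma \<phi>_spinor: "\<phi> x \<in> spinors S x"
  using smooth_\<phi> by (simp add: smooth_spinor_def)

lemma Hform_f: "x \<in> U \<Longrightarrow> Hform (f x) (f x) = 1"
  using spinor_H_eq[OF \<phi>_spinor over] norm_\<phi> by (simp add: f_def)

lemma xi_eq:
  "x \<in> U \<Longrightarrow> X \<in> T x \<Longrightarrow> Y \<in> fibre (bundleE S) x \<Longrightarrow>
    xi S \<phi> x (X, Y) = qconj (f x) \<odot> vec_coord S (s1 x) (s2 x) (X, Y) \<odot> qhat (f x)"
  unfolding xi_def f_def by (rule spinor_pair_clifford[OF \<phi>_spinor over])

lemma onb_e: "x \<in> U \<Longrightarrow> is_lorentz_onb (atlas S) (metricM S) x (e1 x, e2 x)"
  using cover_M[OF over(1), of x] by (simp add: e1_def e2_def over)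

lemma e_mem: "x \<in> U \<Longrightarrow> e1 x \<in> T x" "x \<in> U \<Longrightarrow> e2 x \<in> T x"
  using cover_M_mem[OF over(1), of x] by (simp_all add: e1_def e2_def over)

lemma metric_e:
  assumes "x \<in> U"
  shows "metricM S x (e1 x) (e1 x) = - 1" "metricM S x (e2 x) (e2 x) = 1" "metricM S x (e1 x) (e2 x) = 0"
    "metricM S x (e2 x) (e1 x) = 0"
  using onb_e[OF assms] metric_T_sym[OF e_mem[OF assms]] by (simp_all add: is_lorentz_onb_def)

lemma vec_coord_T:
  assumes "x \<in> U"
  shows "vec_coord S (s1 x) (s2 x) (X, 0) = hq (\<i> * of_real (- metricM S x X (e1 x))) (of_real (metricM S x X (e2 x))) 0 0"
  using over[OF assms] cover_E_mem[OF over(3)[OF assms]]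
  by (simp add: vec_coord_eq bundle_metric_zero[OF metric_E] e1_def e2_def)

lemma smooth_e: "smooth_section (atlas S) (tangent_bundle (atlas S)) U e1"
  "smooth_section (atlas S) (tangent_bundle (atlas S)) U e2"
  using smooth_e1 smooth_e2 by (simp_all add: e1_def[abs_def] e2_def[abs_def])

lemma nabla_mem:
  "smooth_section (atlas S) (tangent_bundle (atlas S)) W Y \<Longrightarrow> p \<in> W \<Longrightarrow> v \<in> T p \<Longrightarrow> nablaM S p v Y \<in> T p"
  using connection_mem[OF connection_T, of W Y p v] by simp

lemma deriv_metric:
  "smooth_section (atlas S) (tangent_bundle (atlas S)) W Y \<Longrightarrow> smooth_section (atlas S) (tangent_bundle (atlas S)) W Z \<Longrightarrow>
   p \<in> W \<Longrightarrow> v \<in> T p \<Longrightarrow>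
   deriv_along (atlas S) p v (\<lambda>x. metricM S x (Y x) (Z x)) =
     metricM S p (nablaM S p v Y) (Z p) + metricM S p (Y p) (nablaM S p v Z)"
  using compatible_T unfolding compatible_def by blast

text \<open>Differentiating the constant products of the frame leaves one coefficient,
  \<open>rot\<close>. Both formulas carry the same sign, as befits an infinitesimal boost, because
  the expansion along \<open>e1\<close> has its own minus sign.\<close>

lemma nabla_e:
  assumes v: "v \<in> T p"
  shows "nablaM S p v e1 = rot v *\<^sub>R e2 p" "nablaM S p v e2 = rot v *\<^sub>R e1 p"
proof -
  note mem = e_mem[OF p] nabla_mem[OF smooth_e(1) p v] nabla_mem[OF smooth_e(2) p v]
  have const: "deriv_along (atlas S) p v (\<lambda>x. metricM S x (Y x) (Z x)) = 0"
    if "\<And>x. x \<in> U \<Longrightarrow> metricM S x (Y x) (Z x) = c" for Y Z c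
    using deriv_along_cong[OF open_U p that] by (simp add: deriv_along_const)
  have "metricM S p (nablaM S p v e1) (e1 p) = 0"
    using deriv_metric[OF smooth_e(1) smooth_e(1) p v] const[OF metric_e(1)] metric_T_sym mem by simp
  then show "nablaM S p v e1 = rot v *\<^sub>R e2 p"
    using onb_expand[OF onb_e[OF p] mem(3)] by (simp add: rot_def)
  have "metricM S p (nablaM S p v e2) (e2 p) = 0"
    using deriv_metric[OF smooth_e(2) smooth_e(2) p v] const[OF metric_e(2)] metric_T_sym mem by simp
  moreover have "metricM S p (nablaM S p v e2) (e1 p) = - rot v"
    using deriv_metric[OF smooth_e(1) smooth_e(2) p v] const[OF metric_e(3)] metric_T_sym mem
    by (simp add: rot_def)
  ultimately show "nablaM S p v e2 = rot v *\<^sub>R e1 p"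
    using onb_expand[OF onb_e[OF p] mem(4)] by simp
qed

text \<open>The number \<open>r\<close>, half the connection coefficient of the normal frame, is
  left unspecified because it cancels in \<open>spin_sandwich_derivative\<close>.\<close>

lemma spin_form_eq: "\<exists>r. spin_form S s1 s2 p v = hq 0 (of_real r - \<i> * of_real (rot v) / 2) 0 0"
proof (intro exI)
  show "spin_form S s1 s2 p v = hq 0 (of_real (1/2 * metricE S p (nablaE S p v (\<lambda>x. fst (cover (spinE S) (s2 x))))
        (snd (cover (spinE S) (s2 p)))) - \<i> * of_real (rot v) / 2) 0 0"
    by (simp add: spin_form_def Let_def rot_def e1_def[abs_def] e2_def hc_eq_iff complex_eq_iff)
qed

text \<open>The ordinary derivative is orthogonal to \<open>f\<close> since
  \<open>Hform (f x) (f x)\<close> is constant, and the connection term is because left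
  multiplication by a multiple of I is skew for \<open>Hform\<close>.\<close>

lemma Hform_nabla_f: "Hform (nabla_f v) (f p) = 0"
proof -
  let ?D = "deriv_along (atlas S) p v"
  have diff: "diff_at (atlas S) p f"
    by (rule smooth_map_diff_at[OF smooth_f p])
  have "?D (\<lambda>x. Hform (f x) (f x)) = 0"
    using deriv_along_cong[OF open_U p Hform_f] by (simp add: deriv_along_const)
  then have "Hform (f p) (?D f) + Hform (?D f) (f p) = 0"
    by (simp add: deriv_along_bilinear[OF diff diff bounded_bilinear_Hform])
  then have "Hform (?D f) (f p) = 0"
    by (simp add: Hform_commute[of "f p"])
  moreover have "Hform (spin_form S s1 s2 p v \<odot> f p) (f p) = 0"
    using spin_form_eq[of v] by (auto simp: Hform_eq algebra_simps)
  ultimately show ?thesis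
    by (simp add: nabla_f_def bounded_bilinear.add_left[OF bounded_bilinear_Hform])
qed

text \<open>The derivative of \<open>\<xi>(w)\<close> with \<open>w\<close> held parallel and
  \<open>\<phi>\<close> differentiated covariantly; it turns out to be the Hessian of
  \<open>F\<close>.\<close>

definition second_deriv where
  "second_deriv v w = qconj (nabla_f v) \<odot> vec_coord S (s1 p) (s2 p) (w, 0) \<odot> qhat (f p)
     + qconj (f p) \<odot> vec_coord S (s1 p) (s2 p) (w, 0) \<odot> qhat (nabla_f v)"

text \<open>Near \<open>p\<close> the function is \<open>qconj f \<odot> [Y] \<odot> qhat f\<close>.
  The product rule produces ordinary derivatives of both coordinates, and their connection terms
  cancel.\<close>

lemma deriv_differential:
  assumes Y: "smooth_section (atlas S) (tangent_bundle (atlas S)) W Y" "p \<in> W" and v: "v \<in> T p"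
  shows "deriv_along (atlas S) p v (\<lambda>x. differential (atlas S) F x (Y x)) =
    differential (atlas S) F p (nablaM S p v Y) + second_deriv v (Y p)"
proof -
  let ?D = "deriv_along (atlas S) p v" and ?TM = "tangent_bundle (atlas S)"
  define y where "y x = vec_coord S (s1 x) (s2 x) (Y x, 0)" for x
  define y1 where "y1 = - metricM S p (Y p) (e1 p)"
  define y2 where "y2 = metricM S p (Y p) (e2 p)"
  define z where "z = vec_coord S (s1 p) (s2 p) (nablaM S p v Y, 0)"
  have W: "open W"
    using Y by (simp add: smooth_section_def)
  have UW: "open (U \<inter> W)" "p \<in> U \<inter> W"
    using open_U W p Y by auto
  note YW = smooth_section_subset[OF Y(1) UW(1) Int_lower2]
  note eW = smooth_section_subset[OF smooth_e(1) UW(1) Int_lower1] smooth_section_subset[OF smooth_e(2) UW(1) Int_lower1]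
  have Y_mem: "Y x \<in> T x" if "x \<in> W" for x
    using Y(1) that by (simp add: smooth_section_def)
  have zero_mem: "0 \<in> fibre (bundleE S) x" for x
    using subspace_E by (rule subspace_0)
  note mem = Y_mem[OF Y(2)] e_mem[OF p] nabla_mem[OF Y v]
  have diff_f: "diff_at (atlas S) p f"
    by (rule smooth_map_diff_at[OF smooth_f p])
  have diff_metric: "diff_at (atlas S) p (\<lambda>x. metricM S x (Y x) (Z x))" if "smooth_section (atlas S) ?TM (U \<inter> W) Z" for Z
    using metric_T YW that UW(2) unfolding bundle_metric_def by (blast intro: smooth_map_diff_at)
  \<comment> \<open>Metric compatibility, with the derivatives of the frame replaced by
    \<open>nabla_e\<close>; the coefficient 0 in \<open>metric_T_right\<close> serves to pull a
    scalar out of the second argument.\<close>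
  have D_metric: "?D (\<lambda>x. metricM S x (Y x) (e1 x)) = metricM S p (nablaM S p v Y) (e1 p) + rot v * y2"
      "?D (\<lambda>x. metricM S x (Y x) (e2 x)) = metricM S p (nablaM S p v Y) (e2 p) - rot v * y1"
    using deriv_metric[OF YW eW(1) UW(2) v] deriv_metric[OF YW eW(2) UW(2) v]
      metric_T_right[of _ p _ _ "rot v" 0] mem
    by (simp_all add: nabla_e[OF v] y1_def y2_def)
  \<comment> \<open>The coordinate of \<open>Y\<close> is written as real functions times the fixed
    quaternions \<open>- \<i> 1\<close> and I, so that it can be differentiated by
    linearity.\<close>
  define y' where "y' x = metricM S x (Y x) (e1 x) *\<^sub>R hq (- \<i>) 0 0 0 + metricM S x (Y x) (e2 x) *\<^sub>R hq 0 1 0 0" for x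
  have y_eq: "y x = y' x" if "x \<in> U \<inter> W" for x
    using that by (simp add: y_def y'_def vec_coord_T hc_eq_iff scaleR_conv_of_real[where 'a = complex])
  note L = bounded_linear_scaleR_left
  have "diff_at (atlas S) p y'"
    unfolding y'_def by (intro deriv_along_add(2) diff_at_linear[OF _ L] diff_metric eW)
  then have diff_y: "diff_at (atlas S) p y"
    using diff_at_cong[OF UW, of y y'] y_eq by simp
  have "?D y = ?D y'"
    by (rule deriv_along_cong[OF UW y_eq])
  also have "\<dots> = ?D (\<lambda>x. metricM S x (Y x) (e1 x)) *\<^sub>R hq (- \<i>) 0 0 0 + ?D (\<lambda>x. metricM S x (Y x) (e2 x)) *\<^sub>R hq 0 1 0 0"
    unfolding y'_def by (simp add: deriv_along_add(1) diff_at_linear[OF _ L] deriv_along_linear[OF _ L] diff_metric eW)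
  finally have Dy: "?D y = z - hq (\<i> * of_real (rot v * y2)) (of_real (rot v * y1)) 0 0"
    unfolding D_metric z_def vec_coord_T[OF p]
    by (simp add: hc_eq_iff complex_eq_iff algebra_simps)
  have yp: "y p = hq (\<i> * of_real y1) (of_real y2) 0 0"
    by (simp add: y_def vec_coord_T[OF p] y1_def y2_def)
  obtain r where r: "spin_form S s1 s2 p v = hq 0 (of_real r - \<i> * of_real (rot v) / 2) 0 0"
    using spin_form_eq by blast
  have Df: "?D f = nabla_f v - hq 0 (of_real r - \<i> * of_real (rot v) / 2) 0 0 \<odot> f p"
    by (simp add: nabla_f_def r)
  have "?D (\<lambda>x. differential (atlas S) F x (Y x)) = ?D (\<lambda>x. qconj (f x) \<odot> y x \<odot> qhat (f x))"
    by (rule deriv_along_cong[OF UW]) (simp add: differential_F Y_mem xi_eq zero_mem y_def)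
  also have "\<dots> = qconj (?D f) \<odot> y p \<odot> qhat (f p) + qconj (f p) \<odot> ?D y \<odot> qhat (f p) + qconj (f p) \<odot> y p \<odot> qhat (?D f)"
    using diff_f diff_y
    by (simp add: deriv_along_bilinear[OF _ _ bounded_bilinear_qmult] diff_at_bilinear[OF _ _ bounded_bilinear_qmult]
        deriv_along_linear[OF _ bounded_linear_qconj] diff_at_linear[OF _ bounded_linear_qconj]
        deriv_along_linear[OF _ bounded_linear_qhat] diff_at_linear[OF _ bounded_linear_qhat]
        qmult_add_left)
  also have "\<dots> = qconj (f p) \<odot> z \<odot> qhat (f p) + (qconj (nabla_f v) \<odot> y p \<odot> qhat (f p) + qconj (f p) \<odot> y p \<odot> qhat (nabla_f v))"
    by (rule spin_sandwich_derivative[OF Df yp Dy])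
  also have "qconj (f p) \<odot> z \<odot> qhat (f p) = differential (atlas S) F p (nablaM S p v Y)"
    by (simp add: differential_F mem xi_eq p zero_mem z_def)
  finally show ?thesis
    by (simp add: second_deriv_def y_def)
qed

text \<open>The combination of the frame fields with constant coefficients extends \<open>w\<close>,
  so the choice in the definition is not vacuous.\<close>

lemma field_extending:
  assumes w: "w \<in> T p"
  obtains W where "p \<in> W" "smooth_section (atlas S) (tangent_bundle (atlas S)) W (field_extending (atlas S) p w)"
    "field_extending (atlas S) p w p = w"
proof -
  define Y where "Y x = (- metricM S p w (e1 p)) *\<^sub>R e1 x + metricM S p w (e2 p) *\<^sub>R e2 x" for x
  have "smooth_section (atlas S) (tangent_bundle (atlas S)) U Y"
    unfolding Y_def[abs_def] by (intro smooth_section_lincomb smooth_e) (simp add: subspace_T)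
  moreover have "Y p = w"
    using onb_expand[OF onb_e[OF p] w] by (simp add: Y_def)
  ultimately have "\<exists>Y W. p \<in> W \<and> smooth_section (atlas S) (tangent_bundle (atlas S)) W Y \<and> Y p = w"
    using p by blast
  from someI_ex[OF this] show thesis
    unfolding field_extending_def[symmetric] using that by blast
qed

lemma hessian_eq:
  assumes "v \<in> T p" "w \<in> T p"
  shows "hessian (atlas S) (nablaM S) F p v w = second_deriv v w"
proof -
  obtain W where W: "p \<in> W" "smooth_section (atlas S) (tangent_bundle (atlas S)) W (field_extending (atlas S) p w)"
    "field_extending (atlas S) p w p = w"
    using field_extending[OF assms(2)] .
  show ?thesis
    by (simp add: hessian_def deriv_differential[OF W(2,1) assms(1)] W(3))
qed

text \<open>In \<open>deriv_differential\<close> the term with \<open>nablaM\<close> is tangential,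
  so once \<open>second_deriv\<close> is orthogonal to the surface it is the normal part.\<close>

lemma second_fundamental_form_eq:
  assumes "v \<in> T p" "w \<in> T p"
    and "\<And>u. u \<in> T p \<Longrightarrow> mink (second_deriv v w) (differential (atlas S) F p u) = 0"
  shows "second_fundamental_form (atlas S) F p v w = second_deriv v w"
proof -
  obtain W where W: "p \<in> W" "smooth_section (atlas S) (tangent_bundle (atlas S)) W (field_extending (atlas S) p w)"
    "field_extending (atlas S) p w p = w"
    using field_extending[OF assms(2)] .
  have "second_deriv v w \<in> R31"
    unfolding second_deriv_def by (rule sandwich_derivative_R31(2)[OF vec_coord_R31])
  then show ?thesis
    unfolding second_fundamental_form_def deriv_differential[OF W(2,1) assms(1)] W(3)
    using assms(3) nabla_mem[OF W(2,1) assms(1)] by (intro normal_part_eq)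
qed

text \<open>The two sides of the Dirac equation are equal as sets of triples; the triple over
  \<open>(s1 p, s2 p)\<close> gives an equation between quaternions. The basis \<open>(a, b)\<close>
  is the one that \<open>dirac\<close> chooses and may differ from the spin frame.\<close>

lemma dirac_coord:
  assumes onb: "lorentz_onb (atlas S) (metricM S) p = (a, b)"
    and dirac: "dirac S \<phi> p = clifford S (0, h) (\<phi> p)"
  shows "- (vec_coord S (s1 p) (s2 p) (a, 0) \<odot> qhat (nabla_f a)) + vec_coord S (s1 p) (s2 p) (b, 0) \<odot> qhat (nabla_f b)
    = vec_coord S (s1 p) (s2 p) (0, h) \<odot> qhat (f p)"
proof -
  have nabla: "(s1 p, s2 p, nabla_f v) \<in> spin_nabla S \<phi> p v" for v
    using p s1 s2 unfolding spin_nabla_def nabla_f_def f_def[abs_def] by blast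
  have cliff: "(s1 p, s2 p, vec_coord S (s1 p) (s2 p) (v, 0) \<odot> qhat (nabla_f v)) \<in> clifford S (v, 0) (spin_nabla S \<phi> p v)" for v
    using nabla[of v] unfolding clifford_def by blast
  have "(s1 p, s2 p, - (vec_coord S (s1 p) (s2 p) (a, 0) \<odot> qhat (nabla_f a)) + vec_coord S (s1 p) (s2 p) (b, 0) \<odot> qhat (nabla_f b))
      \<in> dirac S \<phi> p"
    using cliff[of a] cliff[of b] unfolding dirac_def onb spinor_add_def spinor_neg_def Let_def prod.case by blast
  then obtain \<zeta> where "(s1 p, s2 p, \<zeta>) \<in> \<phi> p"
    "- (vec_coord S (s1 p) (s2 p) (a, 0) \<odot> qhat (nabla_f a)) + vec_coord S (s1 p) (s2 p) (b, 0) \<odot> qhat (nabla_f b)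
      = vec_coord S (s1 p) (s2 p) (0, h) \<odot> qhat \<zeta>"
    unfolding dirac clifford_def by auto
  then show ?thesis
    using coord_unique[OF \<phi>_spinor over[OF p]] by (simp add: f_def)
qed

lemma laplacian_mean_curvature:
  assumes h: "h \<in> fibre (bundleE S) p"
    and dirac: "dirac S \<phi> p = clifford S (0, h) (\<phi> p)"
  shows "laplacian (atlas S) (metricM S) (nablaM S) F p = 2 *\<^sub>R xi S \<phi> p (0, h)"
    and "mean_curvature (atlas S) F p = xi S \<phi> p (0, h)"
proof -
  obtain a b where ab: "lorentz_onb (atlas S) (metricM S) p = (a, b)"
    by fastforce
  have onb: "is_lorentz_onb (atlas S) (metricM S) p (a, b)"
    using lorentz_onb[of p] by (simp add: ab)
  then have a: "a \<in> T p" and b: "b \<in> T p"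
    using is_basis_mem by (auto simp: is_lorentz_onb_def)
  have zero_T: "0 \<in> T p"
    using subspace_T by (rule subspace_0)
  have trace: "- second_deriv a a + second_deriv b b = 2 *\<^sub>R xi S \<phi> p (0, h)"
    unfolding second_deriv_def xi_eq[OF p zero_T h]
    by (rule sandwich_trace[OF vec_coord_R31 vec_coord_R31 vec_coord_R31 dirac_coord[OF ab dirac]])
  then show "laplacian (atlas S) (metricM S) (nablaM S) F p = 2 *\<^sub>R xi S \<phi> p (0, h)"
    by (simp add: laplacian_def lorentz_trace_def ab hessian_eq a b)
  \<comment> \<open>Components of \<open>a\<close> and \<open>b\<close> in the spin frame, the minus
    sign coming from the timelike vector \<open>e1\<close>.\<close>
  define a1 where "a1 = - metricM S p a (e1 p)"
  define b1 where "b1 = metricM S p a (e2 p)"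
  define a2 where "a2 = - metricM S p b (e1 p)"
  define b2 where "b2 = metricM S p b (e2 p)"
  have metric_ab: "metricM S p a a = - a1 * a1 + b1 * b1" "metricM S p b b = - a2 * a2 + b2 * b2"
    "metricM S p a b = - a1 * a2 + b1 * b2"
    using metric_expand[OF onb_e[OF p]] a b by (simp_all add: a1_def b1_def a2_def b2_def)
  \<comment> \<open>Both bases are Lorentz orthonormal, so comparing Gram determinants shows that
    the change of basis has determinant of square 1.\<close>
  have "(a1 * b2 - a2 * b1) * (a1 * b2 - a2 * b1) = 1"
    using onb metric_ab unfolding is_lorentz_onb_def by (simp, algebra)
  then have det: "a1 * b2 - a2 * b1 \<noteq> 0"
    by auto
  have h0: "vec_coord S (s1 p) (s2 p) (0, h) $ 1 = 0" "vec_coord S (s1 p) (s2 p) (0, h) $ 2 = 0"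
    using e_mem[OF p] by (simp_all add: vec_coord_eq over[OF p] bundle_metric_zero[OF metric_T] flip: e1_def e2_def)
  have zero_E: "0 \<in> fibre (bundleE S) p"
    using subspace_E by (rule subspace_0)
  \<comment> \<open>The trace involves only the diagonal entries, so normality is established just
    for the pairs \<open>(a, a)\<close> and \<open>(b, b)\<close>.\<close>
  note normal = sandwich_derivative_normal[OF _ _ det h0 Hform_f[OF p] Hform_nabla_f Hform_nabla_f dirac_coord[OF ab dirac] vec_coord_T[OF p]]
  have "mink (second_deriv a a) (differential (atlas S) F p u) = 0" "mink (second_deriv b b) (differential (atlas S) F p u) = 0"
    if u: "u \<in> T p" for u
    unfolding second_deriv_def differential_F[OF u] xi_eq[OF p u zero_E]
    by (rule normal; simp add: vec_coord_T[OF p] a1_def b1_def a2_def b2_def)+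
  then have "second_fundamental_form (atlas S) F p a a = second_deriv a a"
    "second_fundamental_form (atlas S) F p b b = second_deriv b b"
    using a b by (blast intro: second_fundamental_form_eq)+
  then show "mean_curvature (atlas S) F p = xi S \<phi> p (0, h)"
    using trace by (simp add: mean_curvature_def lorentz_trace_def lorentz_onb_pullback ab)
qed

end

theorem corollary3p5:
  fixes S :: "('m::{t2_space,second_countable_topology}, 'e::real_vector, 'q1, 'q2) spinor_setting"
    and H :: "'m \<Rightarrow> 'e"
    and \<phi> :: "'m \<Rightarrow> ('q1, 'q2) spinor"
    and F :: "'m \<Rightarrow> hc"
  assumes "simply_connected (UNIV :: 'm set)"
    and "timelike_surface S"
    and "riemannian_bundle_E S"
    and "spin_structures S"
    and "smooth_section (atlas S) (bundleE S) UNIV H"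
    and "smooth_spinor S \<phi>"
    and "\<And>p. dirac S \<phi> p = clifford S (0, H p) (\<phi> p)"
    and "\<And>p. spinor_H (\<phi> p) (\<phi> p) = 1"
    and "isometric_immersion (atlas S) (metricM S) F"
    and "\<And>p X. X \<in> tangent (atlas S) p \<Longrightarrow> differential (atlas S) F p X = xi S \<phi> p (X, 0)"
  shows "\<forall>p. laplacian (atlas S) (metricM S) (nablaM S) F p = 2 *\<^sub>R xi S \<phi> p (0, H p)
           \<and> mean_curvature (atlas S) F p = xi S \<phi> p (0, H p)"
proof
  fix p
  interpret spinor_immersion S \<phi> F
    using assms by unfold_locales
  obtain U s1 s2 where frame: "p \<in> U" "local_section (atlas S) Spin11 (spinM S) U s1"
    "local_section (atlas S) Spin2 (spinE S) U s2"
    "smooth_section (atlas S) (tangent_bundle (atlas S)) U (\<lambda>x. fst (cover (spinM S) (s1 x)))"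
    "smooth_section (atlas S) (tangent_bundle (atlas S)) U (\<lambda>x. snd (cover (spinM S) (s1 x)))"
    using local_frame_ex .
  interpret spinor_frame S \<phi> F p U s1 s2
    using frame by unfold_locales
  have "H p \<in> fibre (bundleE S) p"
    using assms(5) by (simp add: smooth_section_def)
  then show "laplacian (atlas S) (metricM S) (nablaM S) F p = 2 *\<^sub>R xi S \<phi> p (0, H p)
      \<and> mean_curvature (atlas S) F p = xi S \<phi> p (0, H p)"
    using laplacian_mean_curvature assms(7) by blast
qed

end
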